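(* Let $r:\mathbb N^*\to(0,\infty)$ be a non-increasing rate function such that $$\sup_{n\in\mathbb N^*} n\,r(n)\le 1\qquad\text{and}\qquad K_r:=\inf_{n\in\mathbb N^*} n\,r(n)>0 .$$ If $\mathbf E^0[\sigma]<K_r\,\mathbf E^0[\xi]$, then the equation $$\mu\circ\theta=\Phi^{r}\left(\mu+\delta_{\sigma},\xi\right),\qquad \mathbf P^0\text{-a.s.},$$ admits a unique (up to $\mathbf P^0$-a.s. equality) finite solution $\mu^r$, i.e. a unique $\mathcal M$-valued random variable solving it. Moreover, for any $\mathcal M$-valued random variable $\zeta$ such that $\langle\zeta,I\rangle\le W^{K_r}$, $\mathbf P^0$-a.s., where $W^{K_r}$ is the unique $\mathbf P^0$-a.s. finite nonnegative solution of $$W\circ\theta=\left[W+\sigma-K_r\xi\right]^+,\qquad \mathbf P^0\text{-a.s.},$$ the sequence $\{\mu_n^{[\zeta]}\}_{n\in\mathbb N}$ defined by $\mu_0^{[\zeta]}=\zeta$ and $\mu_{n+1}^{[\zeta]}=\Phi^r(\mu_n^{[\zeta]}+\delta_{\sigma_n},\xi_n)$, $n\in\mathbb N$, converges with strong backwards coupling to $\mu^r$.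
   Context: Probabilistic setting. $(\Omega,\mathcal F,\mathbf P)$ is a probability space with a bijective measurable flow $(\theta_t)$ under which $\mathbf P$ is stationary and ergodic; on it is defined a $\theta_t$-compatible simple point process $A$ with points $\dots<T_{-1}<T_0\le 0<T_1<\dots$ (arrival times of customers $C_n$), marked by the sequence $\{\sigma_n\}_{n\in\mathbb Z}$ of positive service durations; $\xi_n=T_{n+1}-T_n>0$. $\mathbf P^0$ is the Palm probability of $A$ (with expectation $\mathbf E^0$), $\theta:=\theta_{T_1}$, $\xi:=\xi_0$, $\sigma:=\sigma_0$. Thus on $(\Omega,\mathcal F,\mathbf P^0)$, $\theta$ is a bijective bi-measurable map, $\mathbf P^0$ is $\theta$-stationary ($\mathbf P^0[\theta^{-1}\mathfrak A]=\mathbf P^0[\mathfrak A]$ for all $\mathfrak A\in\mathcal F$) and $\theta$-ergodic ($\theta\mathfrak A=\mathfrak A$ implies $\mathbf P^0[\mathfrak A]\in\{0,1\}$), and $\xi_n=\xi\circ\theta^n$, $\sigma_n=\sigma\circ\theta^n$ for all $n\in\mathbb Z$. The random variables $\xi$ and $\sigma$ are positive and integrable. Measures. $\mathcal M$ is the set of finite counting measures on $(0,\infty)$ (finite sums of Dirac masses, atoms counted with multiplicity, including the zero measure $\mathbf 0$), with the Borel $\sigma$-algebra of the weak topology. A nonzero $\mu\in\mathcal M$ is written $\mu=\sum_{i=1}^{N(\mu)}\delta_{\alpha_i(\mu)}$ with $\alpha_1(\mu)\le\dots\le\alpha_{N(\mu)}(\mu)$, $N(\mu)=\mu((0,\infty))$.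 $\langle\mu,f\rangle=\int f\,d\mu$, $I$ is the identity function, so $\langle\mu,I\rangle$ is the sum of the atoms. For $y\ge0$, $\tau_y\mu=\sum_{i=1}^{N(\mu)}\delta_{\alpha_i(\mu)-y}\mathbf 1_{\{\alpha_i(\mu)>y\}}$. Also $x^+=\max(x,0)$, $a\wedge b=\min(a,b)$, $\mathbb N^*=\{1,2,\dots\}$, empty sums are $0$ and $\max\emptyset=0$. The map $\Phi^r$. For $\mu\in\mathcal M\setminus\{\mathbf 0\}$, $x\ge 0$ and $1\le i\le N(\mu)$, let $$\gamma^r_i(\mu,x)=r(N(\mu)-i+1)\left(x-\sum_{j=1}^{i-1}\alpha_j(\mu)\left(\frac1{r(N(\mu)-j+1)}-\frac1{r(N(\mu)-j)}\right)\right),$$ $i^r(\mu,x)=\max\{i\le N(\mu):\alpha_i(\mu)\le\gamma_i^r(\mu,x)\}$, $\gamma^r(\mu,x)=\gamma^r_{(i^r(\mu,x)+1)\wedge N(\mu)}(\mu,x)$, and $\Phi^r(\mu,x)=\tau_{\gamma^r(\mu,x)}\mu$; $\Phi^r(\mathbf 0,x)=\mathbf 0$. (Queueing meaning: when $n$ customers are present each is served at rate $r(n)$; $\Phi^r(\mu,x)$ is the measure of remaining service requirements after time $x$ without arrivals, starting from $\mu$.) Strong backwards coupling. A sequence of random variables $\{X_n\}_{n\in\mathbb N}$ converges with strong backwards coupling to $Y$ if $\mathbf P^0$-a.s. there is a finite (random) $N'$ such that $X_n\circ\theta^{-n}=Y$ for all $n\ge N'$. *)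

theory Defs
  imports "HOL-Probability.Probability"
begin

section \<open>Finite counting measures on the open half-line\<close>

text \<open>
  A finite sum of Dirac masses, atoms counted with multiplicity, is determined by the multiset of
  its atoms, so the measures \<open>\<delta>\<^sub>a + \<dots> + \<delta>\<^sub>b\<close> are encoded as finite multisets of positive reals;
  \<open>{#}\<close> is the zero measure and \<open>\<mu> + \<delta>\<^sub>s\<close> is \<open>\<mu> + {#s#}\<close>. The function \<open>dirac_sum\<close> is
  the measure a multiset stands for, and \<open>dirac_sum_inject\<close> shows that the encoding is faithful.
\<close>

definition counting_measures :: "real multiset set" where
  "counting_measures = {\<mu>. set_mset \<mu> \<subseteq> {0<..}}"

definition dirac_sum :: "real multiset \<Rightarrow> real measure" where
  "dirac_sum \<mu> = measure_of {0<..} (sets (restrict_space borel {0<..}))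
     (\<lambda>A. \<Sum>a\<in>#\<mu>. indicator A a)"

definition pairing :: "real multiset \<Rightarrow> (real \<Rightarrow> real) \<Rightarrow> real" where
  "pairing \<mu> f = (\<integral>x. f x \<partial>dirac_sum \<mu>)"

definition weak_topology :: "real multiset topology" where
  "weak_topology = topology_generated_by
     {{\<mu> \<in> counting_measures. pairing \<mu> f \<in> U} | f U.
        continuous_on {0<..} f \<and> bounded (f ` {0<..}) \<and> open U}"

definition counting_space :: "real multiset measure" where
  "counting_space = sigma counting_measures {U. openin weak_topology U}"

lemma space_dirac_sum [simp]: "space (dirac_sum \<mu>) = {0<..}"
  unfolding dirac_sum_def
  by (metis sets.space_closed sets.top space_measure_of_conv)

lemma sets_dirac_sum [simp]: "sets (dirac_sum \<mu>) = sets (restrict_space borel {0<..})"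
  unfolding dirac_sum_def
  by (metis Sigma_Algebra.sets.sets_measure_of_eq space_restrict_space2 sets_lborel
        open_greaterThan borel_open)

lemma emeasure_dirac_sum:
  assumes "A \<in> sets (restrict_space borel {0<..})"
  shows "emeasure (dirac_sum \<mu>) A = (\<Sum>a\<in>#\<mu>. indicator A a)"
proof (rule emeasure_measure_of[OF dirac_sum_def])
  show "countably_additive (sets (dirac_sum \<mu>)) (\<lambda>A. \<Sum>a\<in>#\<mu>. indicator A a :: ennreal)"
  proof (rule countably_additiveI)
    fix B :: "nat \<Rightarrow> real set" assume B: "disjoint_family B"
    show "(\<Sum>i. \<Sum>a\<in>#\<mu>. indicator (B i) a) = (\<Sum>a\<in>#\<mu>. indicator (\<Union>i. B i) a :: ennreal)"
    proof (induction \<mu>)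
      case (add x \<mu>)
      then show ?case
        using suminf_indicator[OF B, of x] by (simp add: suminf_add[symmetric])
    qed simp
  qed
qed (use assms in \<open>auto simp: positive_def sets_restrict_space\<close>)

lemma sum_mset_image_eq_sum:
  fixes f :: "'b \<Rightarrow> 'c::comm_semiring_1"
  assumes "finite S" "set_mset \<mu> \<subseteq> S"
  shows "(\<Sum>a\<in>#\<mu>. f a) = (\<Sum>x\<in>S. of_nat (count \<mu> x) * f x)"
  using assms(2)
proof (induction \<mu>)
  case (add x \<mu>)
  have "(\<Sum>s\<in>S. of_nat (count (add_mset x \<mu>) s) * f s)
      = (\<Sum>s\<in>S. of_nat (count \<mu> s) * f s + (if s = x then f s else 0))"
    by (intro sum.cong) (auto simp: algebra_simps)
  also have "\<dots> = (\<Sum>a\<in>#\<mu>. f a) + f x"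
    using add assms(1) by (simp add: sum.distrib)
  finally show ?case by (simp add: add.commute)
qed simp

lemma dirac_sum_eq_distr:
  assumes "\<mu> \<in> counting_measures"
  shows "dirac_sum \<mu> = distr (density (count_space {0<..}) (\<lambda>x. ennreal (of_nat (count \<mu> x))))
     (restrict_space borel {0<..}) (\<lambda>x. x)"
proof (rule measure_eqI)
  fix A assume "A \<in> sets (dirac_sum \<mu>)"
  then have A: "A \<in> sets (restrict_space borel {0<..})" by simp
  then have A0: "A \<subseteq> {0<..}" by (auto simp: sets_restrict_space)
  have \<mu>: "set_mset \<mu> \<subseteq> {0<..}" using assms by (simp add: counting_measures_def)
  have "emeasure (distr (density (count_space {0<..}) (\<lambda>x. ennreal (of_nat (count \<mu> x))))
     (restrict_space borel {0<..}) (\<lambda>x. x)) A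
     = emeasure (density (count_space {0<..}) (\<lambda>x. ennreal (of_nat (count \<mu> x)))) A"
    using A A0 by (subst emeasure_distr) (auto simp: space_restrict_space Int_absorb2)
  also have "\<dots> = (\<integral>\<^sup>+x. ennreal (of_nat (count \<mu> x)) * indicator A x \<partial>count_space {0<..})"
    using A0 by (subst emeasure_density) auto
  also have "\<dots> = (\<Sum>x\<in>set_mset \<mu>. ennreal (of_nat (count \<mu> x)) * indicator A x)"
    using \<mu> by (intro nn_integral_count_space') (auto simp: not_in_iff)
  also have "\<dots> = (\<Sum>a\<in>#\<mu>. indicator A a)"
    by (simp add: sum_mset_image_eq_sum[OF finite_set_mset order_refl] ennreal_of_nat_eq_real_of_nat)
  finally show "emeasure (dirac_sum \<mu>) A = emeasure (distr (density (count_space {0<..})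
      (\<lambda>x. ennreal (of_nat (count \<mu> x)))) (restrict_space borel {0<..}) (\<lambda>x. x)) A"
    using emeasure_dirac_sum[OF A] by simp
qed simp

lemma pairing_eq_sum:
  assumes \<mu>: "\<mu> \<in> counting_measures" and f: "f \<in> borel_measurable (restrict_space borel {0<..})"
  shows "pairing \<mu> f = (\<Sum>a\<in>#\<mu>. f a)"
proof -
  have 0: "set_mset \<mu> \<subseteq> {0<..}" using \<mu> by (simp add: counting_measures_def)
  have "pairing \<mu> f = (\<integral>x. f x \<partial>density (count_space {0<..}) (\<lambda>x. ennreal (of_nat (count \<mu> x))))"
    unfolding pairing_def dirac_sum_eq_distr[OF \<mu>]
    by (rule integral_distr) (use f in \<open>auto simp: space_restrict_space\<close>)
  also have "\<dots> = (\<integral>x. real (count \<mu> x) * f x \<partial>count_space {0<..})"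
    by (subst integral_density) auto
  also have "\<dots> = (\<Sum>x | x \<in> {0<..} \<and> real (count \<mu> x) * f x \<noteq> 0. real (count \<mu> x) * f x)"
    by (rule lebesgue_integral_count_space_finite_support)
       (auto intro: finite_subset[OF _ finite_set_mset[of \<mu>]])
  also have "\<dots> = (\<Sum>x\<in>set_mset \<mu>. real (count \<mu> x) * f x)"
    by (rule sum.mono_neutral_left) (use 0 in \<open>auto simp: not_in_iff\<close>)
  also have "\<dots> = (\<Sum>a\<in>#\<mu>. f a)"
    by (simp add: sum_mset_image_eq_sum[OF finite_set_mset order_refl])
  finally show ?thesis .
qed

lemma pairing_id:
  assumes "\<mu> \<in> counting_measures"
  shows "pairing \<mu> (\<lambda>x. x) = \<Sum>\<^sub># \<mu>"
  using pairing_eq_sum[OF assms, of "\<lambda>x. x"] by (simp add: measurable_restrict_space1)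

lemma dirac_sum_inject:
  assumes "\<mu> \<in> counting_measures" "\<nu> \<in> counting_measures" "dirac_sum \<mu> = dirac_sum \<nu>"
  shows "\<mu> = \<nu>"
proof (rule multiset_eqI)
  fix x :: real
  show "count \<mu> x = count \<nu> x"
  proof (cases "0 < x")
    case True
    have m: "indicator {x} \<in> borel_measurable (restrict_space borel {0<..})"
      by (simp add: measurable_restrict_space1)
    have "real (count \<rho> x) = pairing \<rho> (indicator {x})" if "\<rho> \<in> counting_measures" for \<rho>
    proof -
      have "real (count \<rho> x) = (\<Sum>a\<in>#\<rho>. indicator {x} a)"
        by (induction \<rho>) auto
      then show ?thesis using pairing_eq_sum[OF that m] by simp
    qed
    then have "real (count \<mu> x) = real (count \<nu> x)"
      using assms by (simp add: pairing_def)
    then show ?thesis by simp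
  next
    case False
    then have "x \<notin># \<mu>" "x \<notin># \<nu>" using assms by (auto simp: counting_measures_def)
    then show ?thesis by (simp add: not_in_iff)
  qed
qed

lemma topspace_weak_topology [simp]: "topspace weak_topology = counting_measures"
proof -
  have "counting_measures \<in> {{\<mu> \<in> counting_measures. pairing \<mu> f \<in> U} | f U.
        continuous_on {0<..} f \<and> bounded (f ` {0<..}) \<and> open U}"
    by (auto intro!: exI[of _ "\<lambda>_. 0"] exI[of _ UNIV] continuous_on_const simp: image_constant_conv)
  then show ?thesis
    unfolding weak_topology_def topology_generated_by_topspace by blast
qed

lemma space_counting_space [simp]: "space counting_space = counting_measures"
  unfolding counting_space_def
  by (rule space_measure_of) (use openin_subset[of weak_topology] in auto)


section \<open>The map \<open>\<Phi>\<close> for the service rate function \<open>r\<close>\<close>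

text \<open>\<open>atom \<mu> i\<close> is the \<open>i\<close>-th smallest atom, counted from 1.\<close>

definition atom :: "real multiset \<Rightarrow> nat \<Rightarrow> real" where
  "atom \<mu> i = sorted_list_of_multiset \<mu> ! (i - 1)"

definition shift :: "real \<Rightarrow> real multiset \<Rightarrow> real multiset" where
  "shift y \<mu> = {#a - y. a \<in># {#a \<in># \<mu>. y < a#}#}"

definition gamma_at :: "(nat \<Rightarrow> real) \<Rightarrow> real multiset \<Rightarrow> real \<Rightarrow> nat \<Rightarrow> real" where
  "gamma_at r \<mu> x i = r (size \<mu> - i + 1) *
     (x - (\<Sum>j = 1..<i. atom \<mu> j * (1 / r (size \<mu> - j + 1) - 1 / r (size \<mu> - j))))"

text \<open>The inserted 0 is the convention \<open>max \<emptyset> = 0\<close>.\<close>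

definition last_index :: "(nat \<Rightarrow> real) \<Rightarrow> real multiset \<Rightarrow> real \<Rightarrow> nat" where
  "last_index r \<mu> x = Max (insert 0 {i \<in> {1..size \<mu>}. atom \<mu> i \<le> gamma_at r \<mu> x i})"

definition gamma :: "(nat \<Rightarrow> real) \<Rightarrow> real multiset \<Rightarrow> real \<Rightarrow> real" where
  "gamma r \<mu> x = gamma_at r \<mu> x (min (last_index r \<mu> x + 1) (size \<mu>))"

definition Phi :: "(nat \<Rightarrow> real) \<Rightarrow> real multiset \<Rightarrow> real \<Rightarrow> real multiset" where
  "Phi r \<mu> x = (if \<mu> = {#} then {#} else shift (gamma r \<mu> x) \<mu>)"


section \<open>Stationary ergodic setting\<close>

locale ergodic_automorphism = prob_space P for P :: "'a measure" +
  fixes \<theta> :: "'a \<Rightarrow> 'a"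
  assumes bij: "bij_betw \<theta> (space P) (space P)"
    and measurable: "\<theta> \<in> P \<rightarrow>\<^sub>M P"
    and measurable_inverse: "inv_into (space P) \<theta> \<in> P \<rightarrow>\<^sub>M P"
    and stationary: "\<And>A. A \<in> sets P \<Longrightarrow> prob (\<theta> -` A \<inter> space P) = prob A"
    and ergodic: "\<And>A. A \<in> sets P \<Longrightarrow> \<theta> ` A = A \<Longrightarrow> prob A \<in> {0, 1}"

text \<open>\<open>inv_into (space P) \<theta> ^^ n\<close> is \<open>\<theta>\<^sup>-\<^sup>n\<close>.\<close>

definition strong_backwards_coupling ::
  "'a measure \<Rightarrow> ('a \<Rightarrow> 'a) \<Rightarrow> (nat \<Rightarrow> 'a \<Rightarrow> 'b) \<Rightarrow> ('a \<Rightarrow> 'b) \<Rightarrow> bool" where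
  "strong_backwards_coupling P \<theta> X Y \<longleftrightarrow>
     (AE \<omega> in P. \<exists>N. \<forall>n\<ge>N. X n ((inv_into (space P) \<theta> ^^ n) \<omega>) = Y \<omega>)"

definition rate_inf :: "(nat \<Rightarrow> real) \<Rightarrow> real" where
  "rate_inf r = (INF n\<in>{1..}. real n * r n)"

definition queue_solution ::
  "'a measure \<Rightarrow> ('a \<Rightarrow> 'a) \<Rightarrow> (nat \<Rightarrow> real) \<Rightarrow> ('a \<Rightarrow> real) \<Rightarrow> ('a \<Rightarrow> real) \<Rightarrow>
     ('a \<Rightarrow> real multiset) \<Rightarrow> bool" where
  "queue_solution P \<theta> r \<xi> \<sigma> \<mu> \<longleftrightarrow>
     \<mu> \<in> P \<rightarrow>\<^sub>M counting_space \<and>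
     (AE \<omega> in P. \<mu> (\<theta> \<omega>) = Phi r (\<mu> \<omega> + {#\<sigma> \<omega>#}) (\<xi> \<omega>))"

definition workload_solution ::
  "'a measure \<Rightarrow> ('a \<Rightarrow> 'a) \<Rightarrow> real \<Rightarrow> ('a \<Rightarrow> real) \<Rightarrow> ('a \<Rightarrow> real) \<Rightarrow> ('a \<Rightarrow> real) \<Rightarrow> bool" where
  "workload_solution P \<theta> K \<xi> \<sigma> W \<longleftrightarrow>
     W \<in> borel_measurable P \<and> (AE \<omega> in P. 0 \<le> W \<omega>) \<and>
     (AE \<omega> in P. W (\<theta> \<omega>) = max (W \<omega> + \<sigma> \<omega> - K * \<xi> \<omega>) 0)"

primrec queue_sequence ::
  "('a \<Rightarrow> 'a) \<Rightarrow> (nat \<Rightarrow> real) \<Rightarrow> ('a \<Rightarrow> real) \<Rightarrow> ('a \<Rightarrow> real) \<Rightarrow> ('a \<Rightarrow> real multiset) \<Rightarrow>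
     nat \<Rightarrow> 'a \<Rightarrow> real multiset" where
  "queue_sequence \<theta> r \<xi> \<sigma> \<zeta> 0 = \<zeta>"
| "queue_sequence \<theta> r \<xi> \<sigma> \<zeta> (Suc n) =
     (\<lambda>\<omega>. Phi r (queue_sequence \<theta> r \<xi> \<sigma> \<zeta> n \<omega> + {#\<sigma> ((\<theta> ^^ n) \<omega>)#}) (\<xi> ((\<theta> ^^ n) \<omega>)))"

end

theory Submission
  imports Defs
begin

text \<open>
  With \<open>n\<close> customers present, work is done at total rate \<open>n r n \<ge> K\<close>, so the work of the
  queue is dominated by the workload \<open>W\<close> of a single server of speed \<open>K\<close>. As
  \<open>\<sigma> - K \<xi>\<close> has negative mean, \<open>W\<close> vanishes at some past time, almost surely.
  At that time every queue whose work stays below \<open>W\<close> is empty, so from then on all of them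
  coincide. Any stationary queue has its work below \<open>W\<close>, because this work vanishes
  at some past time, too.
\<close>

section \<open>Work conservation\<close>

text \<open>Two obstacles shape the details. Neither \<open>W\<close> nor the work of an arbitrary
  solution is known to be integrable, so a negative drift cannot simply be integrated: truncated
  increments are integrated instead, and dominated convergence recovers the drift. Moreover, random
  measures carry the Borel sigma-algebra of the weak topology, which is awkward for explicit
  dynamics. Measurability is therefore used in two one-way forms: whatever is constructed is tracked
  through \<open>count_measurable\<close>, which implies measurability into
  \<open>counting_space\<close>; from a given solution only the total work is extracted, as a limit
  of pairings with bounded continuous functions. Loynes' monotone scheme is run on the real-valued
  workload only. The stationary queue is obtained by restarting empty at the most recent zero of
  \<open>W\<close>, so that one coupling statement serves existence, uniqueness and
  convergence.\<close>

lemma atom_mono: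
  assumes "1 \<le> i" "i \<le> j" "j \<le> size \<mu>"
  shows "atom \<mu> i \<le> atom \<mu> j"
proof -
  have "length (sorted_list_of_multiset \<mu>) = size \<mu>"
    by (metis mset_sorted_list_of_multiset size_mset)
  then show ?thesis
    unfolding atom_def using assms by (intro sorted_nth_mono) auto
qed

text \<open>Reindexing by rank: sums and counts over a multiset become sums and cardinalities over
  \<open>{1..size \<mu>}\<close>.\<close>

lemma image_mset_atom: "image_mset (atom \<mu>) (mset_set {1..size \<mu>}) = \<mu>"
proof -
  let ?l = "sorted_list_of_multiset \<mu>"
  have len: "length ?l = size \<mu>"
    by (metis mset_sorted_list_of_multiset size_mset)
  have "image_mset (atom \<mu>) (mset_set {1..size \<mu>})
      = image_mset (atom \<mu>) (image_mset Suc (mset_set {0..<size \<mu>}))"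
    by (simp add: image_mset_mset_set image_Suc_atLeastLessThan atLeastLessThanSuc_atLeastAtMost)
  also have "\<dots> = mset (map ((!) ?l) [0..<size \<mu>])"
    by (simp add: multiset.map_comp o_def atom_def)
  also have "\<dots> = \<mu>"
    using map_nth[of ?l] len by simp
  finally show ?thesis .
qed

lemma atom_mem: "1 \<le> i \<Longrightarrow> i \<le> size \<mu> \<Longrightarrow> atom \<mu> i \<in># \<mu>"
  by (subst (2) image_mset_atom[of \<mu>, symmetric]) auto

lemma sum_mset_atom: "(\<Sum>a\<in>#\<mu>. f a) = (\<Sum>i=1..size \<mu>. f (atom \<mu> i))"
  by (subst (1) image_mset_atom[of \<mu>, symmetric])
     (simp add: multiset.map_comp o_def sum_unfold_sum_mset)

lemma sum_mset_shift: "\<Sum>\<^sub># (shift y \<mu>) = (\<Sum>a\<in>#\<mu>. max (a - y) 0)"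
  unfolding shift_def by (induction \<mu>) auto

lemma shift_in_counting_measures: "shift y \<mu> \<in> counting_measures"
  by (auto simp: shift_def counting_measures_def)

lemma Phi_in_counting_measures: "Phi r \<mu> x \<in> counting_measures"
  using shift_in_counting_measures by (auto simp: Phi_def counting_measures_def)

text \<open>Summation by parts, with \<open>K / r m \<le> m\<close>: until the \<open>i\<close>-th departure
  work is done at total rate at least \<open>K\<close>.\<close>

lemma departed_work_ge:
  assumes r: "\<And>n. 1 \<le> n \<Longrightarrow> 0 < r n" and K: "\<And>n. 1 \<le> n \<Longrightarrow> K \<le> real n * r n"
    and pos: "\<And>j. 1 \<le> j \<Longrightarrow> j \<le> size \<mu> \<Longrightarrow> 0 < atom \<mu> j" and "1 \<le> i" "i < size \<mu>"
  shows "K * (\<Sum>j=1..i. atom \<mu> j * (1 / r (size \<mu> - j + 1) - 1 / r (size \<mu> - j)))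
    \<le> (\<Sum>j=1..i. atom \<mu> j) + atom \<mu> i * (real (size \<mu> - i) - K / r (size \<mu> - i))"
  using \<open>1 \<le> i\<close> \<open>i < size \<mu>\<close>
proof (induction i rule: dec_induct)
  case base
  have "K / r (size \<mu>) \<le> real (size \<mu>)"
    using r[of "size \<mu>"] K[of "size \<mu>"] base by (simp add: divide_simps)
  then have "atom \<mu> 1 * (K / r (size \<mu>)) \<le> atom \<mu> 1 * real (size \<mu>)"
    using pos[of 1] base by (intro mult_left_mono) auto
  moreover have "real (size \<mu> - 1) = real (size \<mu>) - 1" using base by simp
  ultimately show ?case using base by (simp add: algebra_simps)
next
  case (step i)
  let ?N = "size \<mu>"
  have "K / r (?N - i) \<le> real (?N - i)"
    using r[of "?N - i"] K[of "?N - i"] step by (simp add: divide_simps)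
  \<comment> \<open>The factor is nonnegative, so passing to the next atom only raises the boundary
    term; adding summand \<open>Suc i\<close> then cancels \<open>K / r (?N - i)\<close>.\<close>
  then have "atom \<mu> i * (real (?N - i) - K / r (?N - i))
      \<le> atom \<mu> (Suc i) * (real (?N - i) - K / r (?N - i))"
    using step by (intro mult_right_mono atom_mono) auto
  moreover have "real (?N - Suc i) = real (?N - i) - 1" "?N - Suc i + 1 = ?N - i"
    using step by auto
  ultimately show ?case using step by (simp add: algebra_simps)
qed

text \<open>After \<open>L\<close> departures every remaining customer has received the same service
  \<open>y\<close>, so the work done is the sum of the departed atoms plus
  \<open>(N - L) * y\<close>. Solving the formula for \<open>y\<close> for the elapsed time
  \<open>x\<close> reduces the claim to \<open>departed_work_ge\<close>.\<close>

lemma sum_mset_Phi_le: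
  assumes r: "\<And>n. 1 \<le> n \<Longrightarrow> 0 < r n" and K: "\<And>n. 1 \<le> n \<Longrightarrow> K \<le> real n * r n"
    and \<mu>: "\<mu> \<in> counting_measures" and x: "0 \<le> x"
  shows "\<Sum>\<^sub># (Phi r \<mu> x) \<le> max (\<Sum>\<^sub># \<mu> - K * x) 0"
proof (cases "\<mu> = {#}")
  case True
  then show ?thesis by (simp add: Phi_def)
next
  case False
  define N where "N = size \<mu>"
  define \<alpha> where "\<alpha> = atom \<mu>"
  define L where "L = last_index r \<mu> x"
  define y where "y = gamma r \<mu> x"
  define c where "c j = 1 / r (N - j + 1) - 1 / r (N - j)" for j
  have N: "1 \<le> N" using False by (simp add: N_def Suc_le_eq nonempty_has_size)
  have pos: "0 < \<alpha> j" if "1 \<le> j" "j \<le> N" for j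
    using that \<mu> atom_mem[of j \<mu>] by (auto simp: \<alpha>_def N_def counting_measures_def)
  have mono: "\<alpha> i \<le> \<alpha> j" if "1 \<le> i" "i \<le> j" "j \<le> N" for i j
    using that atom_mono by (simp add: \<alpha>_def N_def)
  have g: "gamma_at r \<mu> x i = r (N - i + 1) * (x - (\<Sum>j=1..<i. \<alpha> j * c j))" for i
    by (simp add: gamma_at_def N_def \<alpha>_def c_def)
  let ?S = "insert 0 {i \<in> {1..N}. \<alpha> i \<le> gamma_at r \<mu> x i}"
  have L_Max: "L = Max ?S" by (simp add: L_def last_index_def N_def \<alpha>_def)
  have LN: "L \<le> N" unfolding L_Max by (subst Max_le_iff) auto
  have L_in: "1 \<le> L \<Longrightarrow> \<alpha> L \<le> gamma_at r \<mu> x L"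
    using Max_in[of ?S] unfolding L_Max by auto
  have L_notin: "gamma_at r \<mu> x i < \<alpha> i" if "L < i" "i \<le> N" for i
  proof (rule ccontr)
    assume "\<not> gamma_at r \<mu> x i < \<alpha> i"
    then have "i \<in> ?S" using that by auto
    then have "i \<le> L" unfolding L_Max by (intro Max_ge) auto
    with that show False by simp
  qed
  have sumPhi: "\<Sum>\<^sub># (Phi r \<mu> x) = (\<Sum>i=1..N. max (\<alpha> i - y) 0)"
    using False by (simp add: Phi_def sum_mset_shift sum_mset_atom y_def N_def \<alpha>_def)
  have sum\<mu>: "\<Sum>\<^sub># \<mu> = (\<Sum>i=1..N. \<alpha> i)"
    using sum_mset_atom[of "\<lambda>x. x" \<mu>] by (simp add: N_def \<alpha>_def)
  show ?thesis
  proof (cases "L = N")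
    case True
    \<comment> \<open>The cap in \<open>gamma_def\<close> keeps the index at \<open>N\<close>, where
      the inequality defining \<open>L\<close> holds: the shift is at least the largest
      atom.\<close>
    then have "y = gamma_at r \<mu> x N" by (simp add: y_def gamma_def N_def flip: L_def)
    then have "\<alpha> i \<le> y" if "i \<in> {1..N}" for i
      using L_in True N mono[of i N] that by auto
    then have "(\<Sum>i=1..N. max (\<alpha> i - y) 0) = 0"
      by (intro sum.neutral) (auto simp: max_def)
    then show ?thesis using sumPhi by simp
  next
    case False
    then have L: "L < N" using LN by simp
    then have y_at: "y = gamma_at r \<mu> x (Suc L)"
      by (simp add: y_def gamma_def N_def min_def flip: L_def)
    have "N - Suc L + 1 = N - L" using L by simp
    then have y: "y = r (N - L) * (x - (\<Sum>j=1..L. \<alpha> j * c j))"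
      unfolding y_at g atLeastLessThanSuc_atLeastAtMost by simp
    have rL: "0 < r (N - L)" using r L by simp
    \<comment> \<open>Index \<open>Suc L\<close> fails the inequality defining \<open>L\<close>, and
      \<open>y\<close> is exactly the value compared there.\<close>
    have big: "y < \<alpha> i" if "L < i" "i \<le> N" for i
      using y_at L_notin[of "Suc L"] mono[of "Suc L" i] that L by auto
    have aL: "\<alpha> L \<le> y" if "1 \<le> L"
    proof -
      have "{1..L} = insert L {1..<L}" using that by auto
      then have S: "(\<Sum>j=1..L. \<alpha> j * c j) = \<alpha> L * c L + (\<Sum>j=1..<L. \<alpha> j * c j)" by simp
      have "\<alpha> L \<le> r (N - L + 1) * (x - (\<Sum>j=1..<L. \<alpha> j * c j))"
        using L_in[OF that] g[of L] by simp
      then have "\<alpha> L / r (N - L + 1) \<le> x - (\<Sum>j=1..<L. \<alpha> j * c j)"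
        using r[of "N - L + 1"] by (simp add: pos_divide_le_eq mult.commute)
      \<comment> \<open>The summand \<open>\<alpha> L * c L\<close> exchanges the rate with
        \<open>N - L + 1\<close> customers for the rate with \<open>N - L\<close>, turning the
        condition at index \<open>L\<close> into one on \<open>y\<close>.\<close>
      then have "\<alpha> L / r (N - L) \<le> x - (\<Sum>j=1..L. \<alpha> j * c j)"
        unfolding S by (simp add: c_def right_diff_distrib)
      then show ?thesis using rL y by (simp add: pos_divide_le_eq mult.commute)
    qed
    have small: "\<alpha> i \<le> y" if "1 \<le> i" "i \<le> L" for i
      using aL mono[of i L] that L by auto
    have split: "{1..N} = {1..L} \<union> {L<..N}" using L by auto
    have "(\<Sum>i=1..N. max (\<alpha> i - y) 0) = (\<Sum>i=1..L. max (\<alpha> i - y) 0) + (\<Sum>i\<in>{L<..N}. max (\<alpha> i - y) 0)"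
      unfolding split by (rule sum.union_disjoint) auto
    also have "(\<Sum>i=1..L. max (\<alpha> i - y) 0) = 0"
      using small by (intro sum.neutral) (auto simp: max_def)
    also have "(\<Sum>i\<in>{L<..N}. max (\<alpha> i - y) 0) = (\<Sum>i\<in>{L<..N}. \<alpha> i - y)"
      using big by (intro sum.cong refl max_absorb1) (simp add: less_imp_le)
    also have "\<dots> = (\<Sum>i\<in>{L<..N}. \<alpha> i) - real (N - L) * y"
      by (simp add: sum_subtractf)
    finally have 1: "\<Sum>\<^sub># (Phi r \<mu> x) = (\<Sum>i\<in>{L<..N}. \<alpha> i) - real (N - L) * y"
      using sumPhi by simp
    have 2: "\<Sum>\<^sub># \<mu> = (\<Sum>i=1..L. \<alpha> i) + (\<Sum>i\<in>{L<..N}. \<alpha> i)"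
      unfolding sum\<mu> split by (rule sum.union_disjoint) auto
    have KL: "K / r (N - L) \<le> real (N - L)"
      using r[of "N - L"] K[of "N - L"] L by (simp add: divide_simps)
    have xy: "x = y / r (N - L) + (\<Sum>j=1..L. \<alpha> j * c j)"
      using y rL by simp
    have "K * x \<le> (\<Sum>i=1..L. \<alpha> i) + real (N - L) * y"
    proof (cases "1 \<le> L")
      case True
      have "K * (\<Sum>j=1..L. \<alpha> j * c j) \<le> (\<Sum>j=1..L. \<alpha> j) + \<alpha> L * (real (N - L) - K / r (N - L))"
        using departed_work_ge[OF r K, of \<mu> L] pos True L
        by (simp add: \<alpha>_def N_def c_def)
      \<comment> \<open>With \<open>y\<close> in the boundary term, its part
        \<open>y * (K / r (N - L))\<close> cancels against the one in \<open>K * x\<close> rewritten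
        by \<open>xy\<close>.\<close>
      moreover have "\<alpha> L * (real (N - L) - K / r (N - L)) \<le> y * (real (N - L) - K / r (N - L))"
        using aL[OF True] KL by (intro mult_right_mono) auto
      ultimately show ?thesis by (subst xy) (simp add: algebra_simps)
    next
      case False
      then have "L = 0" by simp
      then have "y = r N * x" using y by simp
      moreover have "K * x \<le> (real N * r N) * x"
        using x K[OF N] by (intro mult_right_mono) auto
      ultimately show ?thesis using \<open>L = 0\<close> by (simp add: mult_ac)
    qed
    then show ?thesis using 1 2 by simp
  qed
qed

section \<open>Measurability of the dynamics\<close>

text \<open>Random multisets whose numbers of atoms with a given, possibly random, property are
  measurable. Unlike measurability into \<open>counting_space\<close>, this is immediately
  preserved by adding a random atom and by random shifts.\<close>

definition count_measurable :: "'a measure \<Rightarrow> ('a \<Rightarrow> real multiset) \<Rightarrow> bool" where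
  "count_measurable M \<mu> \<longleftrightarrow> (\<forall>Q. Measurable.pred (M \<Otimes>\<^sub>M borel) Q \<longrightarrow>
     (\<lambda>\<omega>. size {#a \<in># \<mu> \<omega>. Q (\<omega>, a)#}) \<in> M \<rightarrow>\<^sub>M count_space UNIV)"

lemma count_measurableD:
  "count_measurable M \<mu> \<Longrightarrow> Measurable.pred (M \<Otimes>\<^sub>M borel) Q \<Longrightarrow>
     (\<lambda>\<omega>. size {#a \<in># \<mu> \<omega>. Q (\<omega>, a)#}) \<in> M \<rightarrow>\<^sub>M count_space UNIV"
  by (simp add: count_measurable_def)

lemma count_measurable_empty: "count_measurable M (\<lambda>_. {#})"
  by (simp add: count_measurable_def)

lemma count_measurable_add:
  assumes "count_measurable M \<mu>" and [measurable]: "s \<in> borel_measurable M"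
  shows "count_measurable M (\<lambda>\<omega>. \<mu> \<omega> + {#s \<omega>#})"
  unfolding count_measurable_def
proof (intro allI impI)
  fix Q :: "_ \<times> real \<Rightarrow> bool" assume Q[measurable]: "Measurable.pred (M \<Otimes>\<^sub>M borel) Q"
  note [measurable] = count_measurableD[OF assms(1) Q]
  have "(\<lambda>\<omega>. size {#a \<in># \<mu> \<omega> + {#s \<omega>#}. Q (\<omega>, a)#})
      = (\<lambda>\<omega>. size {#a \<in># \<mu> \<omega>. Q (\<omega>, a)#} + (if Q (\<omega>, s \<omega>) then 1 else 0))"
    by auto
  then show "(\<lambda>\<omega>. size {#a \<in># \<mu> \<omega> + {#s \<omega>#}. Q (\<omega>, a)#}) \<in> M \<rightarrow>\<^sub>M count_space UNIV"
    by simp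
qed

lemma size_filter_shift:
  "size {#a \<in># shift y \<mu>. Q a#} = size {#a \<in># \<mu>. y < a \<and> Q (a - y)#}"
  unfolding shift_def by (induction \<mu>) auto

text \<open>The random shift is absorbed into the predicate; this is why predicates in
  \<open>count_measurable\<close> may depend on \<omega>.\<close>

lemma count_measurable_shift:
  assumes "count_measurable M \<mu>" and [measurable]: "y \<in> borel_measurable M"
  shows "count_measurable M (\<lambda>\<omega>. shift (y \<omega>) (\<mu> \<omega>))"
  unfolding count_measurable_def size_filter_shift
proof (intro allI impI)
  fix Q :: "_ \<times> real \<Rightarrow> bool" assume Q[measurable]: "Measurable.pred (M \<Otimes>\<^sub>M borel) Q"
  have "Measurable.pred (M \<Otimes>\<^sub>M borel) (\<lambda>p. y (fst p) < snd p \<and> Q (fst p, snd p - y (fst p)))"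
    by measurable
  from count_measurableD[OF assms(1) this]
  show "(\<lambda>\<omega>. size {#a \<in># \<mu> \<omega>. y \<omega> < a \<and> Q (\<omega>, a - y \<omega>)#}) \<in> M \<rightarrow>\<^sub>M count_space UNIV"
    by simp
qed

text \<open>Allows a random restart time, as in \<open>stationary_queue\<close>.\<close>

lemma count_measurable_compose_countable:
  fixes k :: "'a \<Rightarrow> 'i::countable"
  assumes "\<And>i. count_measurable M (\<mu> i)" "k \<in> M \<rightarrow>\<^sub>M count_space UNIV"
  shows "count_measurable M (\<lambda>\<omega>. \<mu> (k \<omega>) \<omega>)"
  unfolding count_measurable_def
proof (intro allI impI)
  fix Q :: "_ \<times> real \<Rightarrow> bool" assume "Measurable.pred (M \<Otimes>\<^sub>M borel) Q"
  then show "(\<lambda>\<omega>. size {#a \<in># \<mu> (k \<omega>) \<omega>. Q (\<omega>, a)#}) \<in> M \<rightarrow>\<^sub>M count_space UNIV"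
    using assms
    by (intro measurable_compose_countable[where f = "\<lambda>i \<omega>. size {#a \<in># \<mu> i \<omega>. Q (\<omega>, a)#}" and g = k]
        count_measurableD) auto
qed

section \<open>Order statistics as random variables\<close>

lemma measurable_size:
  assumes "count_measurable M \<mu>"
  shows "(\<lambda>\<omega>. size (\<mu> \<omega>)) \<in> M \<rightarrow>\<^sub>M count_space UNIV"
  using count_measurableD[OF assms, of "\<lambda>_. True"] by simp

lemma size_filter_atom: "size {#a \<in># \<mu>. Q a#} = card {i \<in> {1..size \<mu>}. Q (atom \<mu> i)}"
proof -
  have "{#a \<in># \<mu>. Q a#} = {#a \<in># image_mset (atom \<mu>) (mset_set {1..size \<mu>}). Q a#}"
    by (simp only: image_mset_atom)
  also have "size \<dots> = size (filter_mset (\<lambda>i. Q (atom \<mu> i)) (mset_set {1..size \<mu>}))"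
    by (simp only: filter_mset_image_mset size_image_mset)
  also have "\<dots> = card {i \<in> {1..size \<mu>}. Q (atom \<mu> i)}"
    by (simp add: filter_mset_mset_set)
  finally show ?thesis .
qed

text \<open>Duality between order statistics and counting functions; it converts measurable counts
  into measurable atoms.\<close>

lemma atom_le_iff:
  assumes "1 \<le> i" "i \<le> size \<mu>"
  shows "atom \<mu> i \<le> c \<longleftrightarrow> i \<le> size {#a \<in># \<mu>. a \<le> c#}"
proof
  assume "atom \<mu> i \<le> c"
  then have "atom \<mu> j \<le> c" if "1 \<le> j" "j \<le> i" for j
    using atom_mono[of j i \<mu>] that assms by linarith
  then have "{1..i} \<subseteq> {j \<in> {1..size \<mu>}. atom \<mu> j \<le> c}"
    using assms by auto
  then have "card {1..i} \<le> card {j \<in> {1..size \<mu>}. atom \<mu> j \<le> c}"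
    by (intro card_mono) auto
  then show "i \<le> size {#a \<in># \<mu>. a \<le> c#}" by (simp add: size_filter_atom)
next
  assume le: "i \<le> size {#a \<in># \<mu>. a \<le> c#}"
  show "atom \<mu> i \<le> c"
  proof (rule ccontr)
    assume c: "\<not> atom \<mu> i \<le> c"
    have "j < i" if "1 \<le> j" "j \<le> size \<mu>" "atom \<mu> j \<le> c" for j
      using atom_mono[of i j \<mu>] assms that c by linarith
    then have "{j \<in> {1..size \<mu>}. atom \<mu> j \<le> c} \<subseteq> {1..<i}" by auto
    then have "card {j \<in> {1..size \<mu>}. atom \<mu> j \<le> c} \<le> card {1..<i}"
      by (intro card_mono) auto
    with le assms show False by (simp add: size_filter_atom)
  qed
qed

text \<open>Outside \<open>{1..size \<mu>}\<close> the value of \<open>atom\<close> is unspecified; it is replaced by 1.\<close>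

definition padded_atom :: "real multiset \<Rightarrow> nat \<Rightarrow> real" where
  "padded_atom \<mu> i = (if 1 \<le> i \<and> i \<le> size \<mu> then atom \<mu> i else 1)"

lemma measurable_padded_atom:
  assumes "count_measurable M \<mu>"
  shows "(\<lambda>\<omega>. padded_atom (\<mu> \<omega>) i) \<in> borel_measurable M"
  unfolding borel_measurable_iff_le
proof
  fix c :: real
  note [measurable] = measurable_size[OF assms]
  have "(\<lambda>\<omega>. size {#a \<in># \<mu> \<omega>. snd (\<omega>, a) \<le> c#}) \<in> M \<rightarrow>\<^sub>M count_space UNIV"
    by (rule count_measurableD[OF assms]) measurable
  then have [measurable]: "(\<lambda>\<omega>. size {#a \<in># \<mu> \<omega>. a \<le> c#}) \<in> M \<rightarrow>\<^sub>M count_space UNIV" by simp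
  have "{\<omega> \<in> space M. padded_atom (\<mu> \<omega>) i \<le> c} = {\<omega> \<in> space M.
      if 1 \<le> i \<and> i \<le> size (\<mu> \<omega>) then i \<le> size {#a \<in># \<mu> \<omega>. a \<le> c#} else 1 \<le> c}"
    by (auto simp: padded_atom_def atom_le_iff)
  then show "{\<omega> \<in> space M. padded_atom (\<mu> \<omega>) i \<le> c} \<in> sets M" by simp
qed

lemma measurable_gamma:
  assumes \<mu>: "count_measurable M \<mu>" and [measurable]: "x \<in> borel_measurable M"
  shows "(\<lambda>\<omega>. gamma r (\<mu> \<omega>) (x \<omega>)) \<in> borel_measurable M"
proof -
  note [measurable] = measurable_size[OF \<mu>] measurable_padded_atom[OF \<mu>]
  \<comment> \<open>Padding makes \<open>g i\<close> measurable for each fixed \<open>i\<close>. It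
    agrees with \<open>gamma_at\<close> for \<open>i\<close> up to the size, and the
    \<open>min\<close> in \<open>gamma_def\<close> selects only such indices.\<close>
  define g where "g i \<omega> = r (size (\<mu> \<omega>) - i + 1) * (x \<omega> - (\<Sum>j=1..<i. padded_atom (\<mu> \<omega>) j *
    (1 / r (size (\<mu> \<omega>) - j + 1) - 1 / r (size (\<mu> \<omega>) - j))))" for i \<omega>
  have [measurable]: "(\<lambda>\<omega>. r (size (\<mu> \<omega>) - i + 1)) \<in> borel_measurable M"
    "(\<lambda>\<omega>. r (size (\<mu> \<omega>) - i)) \<in> borel_measurable M" for i
    by (rule measurable_compose[OF measurable_size[OF \<mu>]], simp)+
  have g_meas[measurable]: "g i \<in> borel_measurable M" for i
    unfolding g_def by measurable
  have g: "gamma_at r (\<mu> \<omega>) (x \<omega>) i = g i \<omega>" if "i \<le> size (\<mu> \<omega>)" for i \<omega>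
    unfolding gamma_at_def g_def padded_atom_def
    using that by (intro arg_cong2[of _ _ _ _ "(*)"] arg_cong2[of _ _ _ _ "(-)"] sum.cong) auto
  have "insert 0 {i \<in> {1..size (\<mu> \<omega>)}. atom (\<mu> \<omega>) i \<le> gamma_at r (\<mu> \<omega>) (x \<omega>) i}
      = {i. i = 0 \<or> 1 \<le> i \<and> i \<le> size (\<mu> \<omega>) \<and> padded_atom (\<mu> \<omega>) i \<le> g i \<omega>}" for \<omega>
    by (auto simp: g padded_atom_def)
  then have "(\<lambda>\<omega>. last_index r (\<mu> \<omega>) (x \<omega>)) = (\<lambda>\<omega>. Max
      {i. i = 0 \<or> 1 \<le> i \<and> i \<le> size (\<mu> \<omega>) \<and> padded_atom (\<mu> \<omega>) i \<le> g i \<omega>})"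
    by (simp add: last_index_def)
  then have [measurable]: "(\<lambda>\<omega>. last_index r (\<mu> \<omega>) (x \<omega>)) \<in> M \<rightarrow>\<^sub>M count_space UNIV"
    by simp
  have "(\<lambda>\<omega>. gamma r (\<mu> \<omega>) (x \<omega>)) = (\<lambda>\<omega>. g (min (last_index r (\<mu> \<omega>) (x \<omega>) + 1) (size (\<mu> \<omega>))) \<omega>)"
    by (simp add: gamma_def g)
  moreover have "(\<lambda>\<omega>. g (min (last_index r (\<mu> \<omega>) (x \<omega>) + 1) (size (\<mu> \<omega>))) \<omega>) \<in> borel_measurable M"
    by (rule measurable_compose_countable[OF g_meas]) measurable
  ultimately show ?thesis by simp
qed

lemma count_measurable_Phi:
  assumes "count_measurable M \<mu>" "x \<in> borel_measurable M"
  shows "count_measurable M (\<lambda>\<omega>. Phi r (\<mu> \<omega>) (x \<omega>))"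
proof -
  \<comment> \<open>Shifting the zero measure returns it, so the case split in
    \<open>Phi_def\<close> disappears.\<close>
  have "(\<lambda>\<omega>. Phi r (\<mu> \<omega>) (x \<omega>)) = (\<lambda>\<omega>. shift (gamma r (\<mu> \<omega>) (x \<omega>)) (\<mu> \<omega>))"
    by (auto simp: Phi_def shift_def)
  then show ?thesis
    using count_measurable_shift[OF assms(1) measurable_gamma[OF assms]] by simp
qed

text \<open>The logarithm makes the space of atoms a full product, on which openness is plain.\<close>

lemma continuous_map_exp_mset:
  "continuous_map euclidean weak_topology
     (\<lambda>v :: nat \<Rightarrow> real. image_mset (\<lambda>i. exp (v i)) (mset_set {1..n}))"
  unfolding weak_topology_def continuous_on_generated_topo_iff
proof (intro conjI allI impI)
  let ?F = "\<lambda>v :: nat \<Rightarrow> real. image_mset (\<lambda>i. exp (v i)) (mset_set {1..n})"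
  have F: "?F v \<in> counting_measures" for v by (auto simp: counting_measures_def)
  let ?S = "{{\<mu> \<in> counting_measures. pairing \<mu> f \<in> U} | f U.
    continuous_on {0<..} f \<and> bounded (f ` {0<..}) \<and> open U}"
  show "openin euclidean (?F -` V \<inter> topspace euclidean)" if V_in: "V \<in> ?S" for V
  proof -
    obtain f U where V: "V = {\<mu> \<in> counting_measures. pairing \<mu> f \<in> U}"
      and f: "continuous_on {0<..} f" and U: "open U"
      using V_in by blast
    have "pairing (?F v) f = (\<Sum>i=1..n. f (exp (v i)))" for v
      using pairing_eq_sum[OF F, of f v] f
      by (simp add: borel_measurable_continuous_on_restrict multiset.map_comp o_def sum_unfold_sum_mset)
    then have "?F -` V = (\<lambda>v. \<Sum>i=1..n. f (exp (v i))) -` U"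
      using F by (auto simp: V)
    moreover have "continuous_on UNIV (\<lambda>v :: nat \<Rightarrow> real. \<Sum>i=1..n. f (exp (v i)))"
      by (intro continuous_on_sum continuous_on_compose2[OF f] continuous_intros) auto
    ultimately show ?thesis using open_vimage[OF U] by simp
  qed
  have "counting_measures \<subseteq> \<Union>?S"
    using topspace_weak_topology unfolding weak_topology_def topology_generated_by_topspace by simp
  then show "?F ` topspace euclidean \<subseteq> \<Union>?S" using F by blast
qed

text \<open>On the event that there are \<open>n\<close> atoms, the random measure is a continuous
  image of the logarithms of its atoms, so a weakly open set pulls back to an open set of real
  sequences. Countably many \<open>n\<close> remain.\<close>

lemma measurable_counting_space:
  assumes \<mu>: "count_measurable M \<mu>" and "\<And>\<omega>. \<omega> \<in> space M \<Longrightarrow> \<mu> \<omega> \<in> counting_measures"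
  shows "\<mu> \<in> M \<rightarrow>\<^sub>M counting_space"
  unfolding counting_space_def
proof (rule measurable_measure_of)
  show "{U. openin weak_topology U} \<subseteq> Pow counting_measures"
    using openin_subset[of weak_topology] by auto
  show "\<mu> \<in> space M \<rightarrow> counting_measures" using assms by auto
  fix U assume "U \<in> {U. openin weak_topology U}"
  then have U: "openin weak_topology U" by simp
  note [measurable] = measurable_size[OF \<mu>] measurable_padded_atom[OF \<mu>]
  define F where "F n v = image_mset (\<lambda>i. exp (v i)) (mset_set {1..n})" for n :: nat and v :: "nat \<Rightarrow> real"
  \<comment> \<open>Atoms are positive, so \<open>exp\<close> recovers them. Beyond the number of
    atoms the padding gives coordinate 0, which \<open>F\<close> ignores.\<close>
  define a where "a \<omega> i = ln (padded_atom (\<mu> \<omega>) i)" for \<omega> i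
  have a[measurable]: "a \<in> borel_measurable M"
    by (rule measurable_coordinatewise_then_product) (simp add: a_def)
  have "open (F n -` U)" for n
    using openin_continuous_map_preimage[OF continuous_map_exp_mset[of n] U]
    by (simp add: F_def vimage_def)
  then have [measurable]: "F n -` U \<in> sets borel" for n by simp
  have eq: "\<mu> \<omega> = F (size (\<mu> \<omega>)) (a \<omega>)" if "\<omega> \<in> space M" for \<omega>
  proof -
    have "exp (a \<omega> i) = atom (\<mu> \<omega>) i" if "i \<in> {1..size (\<mu> \<omega>)}" for i
      using that atom_mem[of i "\<mu> \<omega>"] assms(2)[OF \<open>\<omega> \<in> space M\<close>]
      by (auto simp: a_def padded_atom_def counting_measures_def)
    then have "F (size (\<mu> \<omega>)) (a \<omega>) = image_mset (atom (\<mu> \<omega>)) (mset_set {1..size (\<mu> \<omega>)})"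
      unfolding F_def by (intro image_mset_cong) auto
    then show ?thesis by (simp only: image_mset_atom)
  qed
  have "\<mu> -` U \<inter> space M = {\<omega> \<in> space M. \<exists>n. size (\<mu> \<omega>) = n \<and> a \<omega> \<in> F n -` U}"
    using eq by auto
  also have "\<dots> \<in> sets M" by measurable
  finally show "\<mu> -` U \<inter> space M \<in> sets M" .
qed

lemma measurable_pairing:
  assumes "continuous_on {0<..} f" "bounded (f ` {0<..})"
  shows "(\<lambda>\<mu>. pairing \<mu> f) \<in> borel_measurable counting_space"
proof (rule borel_measurableI)
  fix U :: "real set" assume "open U"
  then have "openin weak_topology {\<mu> \<in> counting_measures. pairing \<mu> f \<in> U}"
    unfolding weak_topology_def using assms by (intro topology_generated_by_Basis) blast
  then have "{\<mu> \<in> counting_measures. pairing \<mu> f \<in> U} \<in> sets counting_space"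
    unfolding counting_space_def
    using openin_subset[of weak_topology] by (intro sigma_sets.Basic in_measure_of) auto
  moreover have "(\<lambda>\<mu>. pairing \<mu> f) -` U \<inter> space counting_space
      = {\<mu> \<in> counting_measures. pairing \<mu> f \<in> U}" by auto
  ultimately show "(\<lambda>\<mu>. pairing \<mu> f) -` U \<inter> space counting_space \<in> sets counting_space" by simp
qed

text \<open>The identity is not bounded, hence the truncation.\<close>

lemma measurable_sum_mset: "sum_mset \<in> borel_measurable counting_space"
proof (rule borel_measurable_LIMSEQ_real)
  let ?f = "\<lambda>n a. min a (real n)"
  show "(\<lambda>\<mu>. pairing \<mu> (?f n)) \<in> borel_measurable counting_space" for n
  proof (rule measurable_pairing)
    show "bounded (?f n ` {0<..})"
      by (rule bounded_subset[of "{0..real n}"]) auto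
  qed (intro continuous_intros)
  fix \<mu> assume "\<mu> \<in> space counting_space"
  then have "pairing \<mu> (?f n) = (\<Sum>a\<in>#\<mu>. ?f n a)" for n
    by (intro pairing_eq_sum) (auto intro!: measurable_restrict_space1)
  moreover have "(\<lambda>n. \<Sum>a\<in>#\<nu>. ?f n a) \<longlonglongrightarrow> \<Sum>\<^sub># \<nu>" for \<nu>
  proof (induction \<nu>)
    case (add a \<nu>)
    have "eventually (\<lambda>n. ?f n a = a) sequentially"
      using eventually_ge_at_top[of "nat \<lceil>a\<rceil>"] by eventually_elim (simp add: min_def nat_ceiling_le_eq)
    then have "(\<lambda>n. ?f n a) \<longlonglongrightarrow> a" by (rule tendsto_eventually)
    from tendsto_add[OF this add] show ?case by simp
  qed simp
  ultimately show "(\<lambda>n. pairing \<mu> (?f n)) \<longlonglongrightarrow> \<Sum>\<^sub># \<mu>" by simp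
qed

section \<open>Past recurrence and workloads\<close>

context ergodic_automorphism
begin

section \<open>The flow and its inverse\<close>

abbreviation prev :: "'a \<Rightarrow> 'a" where
  "prev \<equiv> inv_into (space P) \<theta>"

lemma flow_simps [simp]:
  assumes "\<omega> \<in> space P"
  shows "\<theta> \<omega> \<in> space P" "prev \<omega> \<in> space P" "\<theta> (prev \<omega>) = \<omega>" "prev (\<theta> \<omega>) = \<omega>"
  using assms bij
  by (auto simp: bij_betw_def inv_into_into f_inv_into_f)

lemma funpow_prev_in_space [simp]: "\<omega> \<in> space P \<Longrightarrow> (prev ^^ n) \<omega> \<in> space P"
  by (induction n) auto

lemma funpow_flow_prev:
  "\<omega> \<in> space P \<Longrightarrow> j \<le> n \<Longrightarrow> (\<theta> ^^ j) ((prev ^^ n) \<omega>) = (prev ^^ (n - j)) \<omega>"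
proof (induction j)
  case (Suc j)
  then have "(prev ^^ (n - j)) \<omega> = prev ((prev ^^ (n - Suc j)) \<omega>)"
    by (metis Suc_diff_Suc Suc_le_lessD funpow.simps(2) o_apply)
  then show ?case using Suc by simp
qed simp

lemma funpow_prev_flow:
  "\<omega> \<in> space P \<Longrightarrow> (prev ^^ Suc n) (\<theta> \<omega>) = (prev ^^ n) \<omega>"
  by (simp add: funpow_swap1)

lemmas [measurable] = measurable measurable_inverse

lemma distr_flow: "distr P P \<theta> = P"
  by (rule measure_eqI) (auto simp: emeasure_distr emeasure_eq_measure stationary)

lemma distr_prev: "distr P P prev = P"
proof -
  have "distr P P prev = distr (distr P P \<theta>) P prev" by (simp add: distr_flow)
  also have "\<dots> = distr P P (prev \<circ> \<theta>)" by (rule distr_distr) measurable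
  also have "\<dots> = distr P P (\<lambda>x. x)" by (rule distr_cong) auto
  finally show ?thesis by (simp add: distr_id2)
qed

lemma distr_funpow:
  assumes [measurable]: "f \<in> P \<rightarrow>\<^sub>M P" and "distr P P f = P"
  shows "distr P P (f ^^ n) = P"
proof (induction n)
  case 0
  then show ?case by (simp add: distr_id2 id_def)
next
  case (Suc n)
  have "distr P P (f ^^ Suc n) = distr P P (f \<circ> f ^^ n)" by simp
  also have "\<dots> = distr (distr P P (f ^^ n)) P f" by (rule distr_distr[symmetric]) measurable
  finally show ?case unfolding Suc assms(2) .
qed

lemma AE_funpow_flow: "AE \<omega> in P. Q \<omega> \<Longrightarrow> AE \<omega> in P. Q ((\<theta> ^^ n) \<omega>)"
  by (rule AE_distrD[where M = P and M' = P])
     (simp_all only: distr_funpow[OF measurable distr_flow] measurable_compose_n[OF measurable])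

lemma AE_funpow_prev: "AE \<omega> in P. Q \<omega> \<Longrightarrow> AE \<omega> in P. Q ((prev ^^ n) \<omega>)"
  by (rule AE_distrD[where M = P and M' = P])
     (simp_all only: distr_funpow[OF measurable_inverse distr_prev] measurable_compose_n[OF measurable_inverse])

text \<open>One null set for the whole past orbit, after which the comparisons of trajectories are
  pathwise.\<close>

lemma AE_past: "AE \<omega> in P. Q \<omega> \<Longrightarrow> AE \<omega> in P. \<forall>n. Q ((prev ^^ n) \<omega>)"
  by (simp add: AE_all_countable AE_funpow_prev)

lemma integral_flow:
  fixes f :: "'a \<Rightarrow> real"
  assumes "f \<in> borel_measurable P"
  shows "(\<integral>\<omega>. f (\<theta> \<omega>) \<partial>P) = (\<integral>\<omega>. f \<omega> \<partial>P)"
  using integral_distr[OF measurable assms] distr_flow by simp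

lemma integrable_prev:
  fixes f :: "'a \<Rightarrow> real"
  assumes "integrable P f"
  shows "integrable P (\<lambda>\<omega>. f (prev \<omega>))"
  by (rule integrable_distr[OF measurable_inverse]) (simp add: distr_prev assms)

section \<open>Ergodicity and recurrence\<close>

lemma prob_invariant:
  assumes A: "A \<in> sets P" and inv: "\<And>\<omega>. \<omega> \<in> space P \<Longrightarrow> \<theta> \<omega> \<in> A \<longleftrightarrow> \<omega> \<in> A"
  shows "prob A = 0 \<or> prob A = 1"
proof -
  have "\<theta> ` A = A"
  proof (intro subset_antisym subsetI)
    fix x assume "x \<in> A"
    then have x: "x \<in> space P" using sets.sets_into_space[OF A] by auto
    then have "prev x \<in> A" using inv[of "prev x"] \<open>x \<in> A\<close> by simp
    then show "x \<in> \<theta> ` A" using x by (metis flow_simps(3) imageI)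
  qed (use inv sets.sets_into_space[OF A] in auto)
  then show ?thesis using ergodic[OF A] by auto
qed

text \<open>Visiting \<open>A\<close> at least once in the past need not be an invariant event, but
  visiting it infinitely often is. That event \<open>C\<close> has probability at least
  \<open>prob A\<close>, because each \<open>B n\<close> contains the preimage of \<open>A\<close>
  under \<open>prev ^^ n\<close>; by ergodicity its probability is 1.\<close>

lemma past_recurrence:
  assumes A[measurable]: "A \<in> sets P" and "0 < prob A"
  shows "AE \<omega> in P. \<exists>k. (prev ^^ k) \<omega> \<in> A"
proof -
  define B where "B n = {\<omega> \<in> space P. \<exists>k\<ge>n. (prev ^^ k) \<omega> \<in> A}" for n
  have B[measurable]: "B n \<in> sets P" for n unfolding B_def by measurable
  define C where "C = (\<Inter>n. B n)"
  have C: "C \<in> sets P" unfolding C_def by measurable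
  have "\<theta> \<omega> \<in> C \<longleftrightarrow> \<omega> \<in> C" if "\<omega> \<in> space P" for \<omega>
  proof
    assume *: "\<theta> \<omega> \<in> C"
    have "\<omega> \<in> B n" for n
    proof -
      have "\<theta> \<omega> \<in> B (Suc n)" using * by (auto simp: C_def)
      then obtain k where k: "Suc n \<le> k" "(prev ^^ k) (\<theta> \<omega>) \<in> A" by (auto simp: B_def)
      then obtain k' where "k = Suc k'" by (cases k) auto
      then show ?thesis using k that funpow_prev_flow[OF that, of k'] by (auto simp: B_def)
    qed
    then show "\<omega> \<in> C" by (auto simp: C_def)
  next
    assume *: "\<omega> \<in> C"
    have "\<theta> \<omega> \<in> B n" for n
    proof -
      have "\<omega> \<in> B n" using * by (auto simp: C_def)
      then obtain k where "n \<le> k" "(prev ^^ k) \<omega> \<in> A" by (auto simp: B_def)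
      then show ?thesis using that funpow_prev_flow[OF that, of k]
        by (auto simp: B_def simp del: funpow.simps intro!: exI[of _ "Suc k"])
    qed
    then show "\<theta> \<omega> \<in> C" by (auto simp: C_def)
  qed
  then have "prob C = 0 \<or> prob C = 1" by (rule prob_invariant[OF C])
  moreover have "prob A \<le> prob C"
  proof (rule LIMSEQ_le_const)
    show "(\<lambda>n. prob (B n)) \<longlonglongrightarrow> prob C"
      unfolding C_def
      by (rule finite_Lim_measure_decseq) (auto simp: decseq_def B_def intro: order_trans)
    have "prob A \<le> prob (B n)" for n
    proof -
      have "prob A = measure (distr P P (prev ^^ n)) A"
        by (simp add: distr_funpow distr_prev)
      also have "\<dots> = prob ((prev ^^ n) -` A \<inter> space P)"
        by (rule measure_distr) measurable
      also have "\<dots> \<le> prob (B n)"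
        by (rule finite_measure_mono) (auto simp: B_def)
      finally show ?thesis .
    qed
    then show "\<exists>N. \<forall>n\<ge>N. prob A \<le> prob (B n)" by auto
  qed
  ultimately have "prob C = 1" using \<open>0 < prob A\<close> by auto
  then have "AE \<omega> in P. \<omega> \<in> C" by (rule AE_prob_1)
  then show ?thesis by eventually_elim (auto simp: C_def B_def)
qed

text \<open>If \<open>S\<close> never vanished, the truncations \<open>min S M\<close> would decrease in
  mean by about \<open>\<integral>X\<close>, which stationarity forbids.\<close>

lemma subsolution_hits_zero:
  fixes S X :: "'a \<Rightarrow> real"
  assumes S[measurable]: "S \<in> borel_measurable P" and nonneg: "AE \<omega> in P. 0 \<le> S \<omega>"
    and sub: "AE \<omega> in P. S (\<theta> \<omega>) \<le> max (S \<omega> + X \<omega>) 0"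
    and X: "integrable P X" "(\<integral>\<omega>. X \<omega> \<partial>P) < 0"
  shows "AE \<omega> in P. \<exists>k. S ((prev ^^ k) \<omega>) = 0"
proof -
  let ?A = "{\<omega> \<in> space P. S \<omega> = 0}"
  have "prob ?A \<noteq> 0"
  proof
    assume "prob ?A = 0"
    then have "AE \<omega> in P. S \<omega> \<noteq> 0"
      by (intro AE_I[of _ _ ?A]) (auto simp: emeasure_eq_measure)
    with nonneg have pos: "AE \<omega> in P. 0 < S \<omega>" by eventually_elim auto
    \<comment> \<open>Positivity one step later makes the maximum in \<open>sub\<close> equal to its
      first argument.\<close>
    from AE_funpow_flow[OF this, of 1] have "AE \<omega> in P. 0 < S (\<theta> \<omega>)" by simp
    with sub have drift: "AE \<omega> in P. S (\<theta> \<omega>) \<le> S \<omega> + X \<omega>" by eventually_elim auto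
    have [measurable]: "X \<in> borel_measurable P" using X by auto
    \<comment> \<open>Bound for the increment of the truncation: where
      \<open>S \<omega> \<le> n\<close> it is at most \<open>X \<omega>\<close>, elsewhere at most
      0. By stationarity the increment has mean 0.\<close>
    let ?Y = "\<lambda>n \<omega>. if S \<omega> \<le> real n then X \<omega> else 0"
    have "0 \<le> (\<integral>\<omega>. ?Y n \<omega> \<partial>P)" for n
    proof -
      have "integrable P (\<lambda>\<omega>. min (S \<omega>) (real n))"
        using pos by (auto intro!: integrable_const_bound[where B = "real n"] elim!: eventually_mono)
      moreover have "integrable P (\<lambda>\<omega>. min (S (\<theta> \<omega>)) (real n))"
        using \<open>AE \<omega> in P. 0 < S (\<theta> \<omega>)\<close>
        by (auto intro!: integrable_const_bound[where B = "real n"] elim!: eventually_mono)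
      ultimately have int: "integrable P (\<lambda>\<omega>. min (S \<omega>) (real n))"
        "integrable P (\<lambda>\<omega>. min (S (\<theta> \<omega>)) (real n))" by auto
      have "0 = (\<integral>\<omega>. min (S (\<theta> \<omega>)) (real n) - min (S \<omega>) (real n) \<partial>P)"
        using int integral_flow[of "\<lambda>\<omega>. min (S \<omega>) (real n)"] by simp
      also have "\<dots> \<le> (\<integral>\<omega>. ?Y n \<omega> \<partial>P)"
      proof (rule integral_mono_AE)
        show "integrable P (?Y n)"
          by (rule Bochner_Integration.integrable_bound[OF X(1)]) auto
        show "AE \<omega> in P. min (S (\<theta> \<omega>)) (real n) - min (S \<omega>) (real n) \<le> ?Y n \<omega>"
          using drift by eventually_elim auto
      qed (use int in auto)
      finally show ?thesis .
    qed
    moreover have "(\<lambda>n. \<integral>\<omega>. ?Y n \<omega> \<partial>P) \<longlonglongrightarrow> (\<integral>\<omega>. X \<omega> \<partial>P)"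
    proof (rule integral_dominated_convergence[where w = "\<lambda>\<omega>. \<bar>X \<omega>\<bar>"])
      show "AE \<omega> in P. (\<lambda>n. ?Y n \<omega>) \<longlonglongrightarrow> X \<omega>"
      proof (rule AE_I2, rule tendsto_eventually)
        fix \<omega>
        show "eventually (\<lambda>n. ?Y n \<omega> = X \<omega>) sequentially"
          using eventually_ge_at_top[of "nat \<lceil>S \<omega>\<rceil>"]
          by eventually_elim (simp add: nat_ceiling_le_eq)
      qed
    qed (use X in auto)
    ultimately have "0 \<le> (\<integral>\<omega>. X \<omega> \<partial>P)"
      by (intro LIMSEQ_le_const) auto
    with X show False by simp
  qed
  then have "0 < prob ?A" using measure_nonneg[of P ?A] by linarith
  then have "AE \<omega> in P. \<exists>k. (prev ^^ k) \<omega> \<in> ?A"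
    by (intro past_recurrence) measurable
  then show ?thesis by eventually_elim auto
qed

text \<open>At some past time \<open>S\<close> is 0, hence below \<open>W\<close>; the recursion is
  monotone in its state and carries the inequality forward to time 0.\<close>

lemma subsolution_le_solution:
  fixes S W X :: "'a \<Rightarrow> real"
  assumes S: "S \<in> borel_measurable P" "AE \<omega> in P. 0 \<le> S \<omega>"
      "AE \<omega> in P. S (\<theta> \<omega>) \<le> max (S \<omega> + X \<omega>) 0"
    and W: "AE \<omega> in P. 0 \<le> W \<omega>" "AE \<omega> in P. W (\<theta> \<omega>) = max (W \<omega> + X \<omega>) 0"
    and X: "integrable P X" "(\<integral>\<omega>. X \<omega> \<partial>P) < 0"
  shows "AE \<omega> in P. S \<omega> \<le> W \<omega>"
  using subsolution_hits_zero[OF S X] AE_past[OF S(3)] AE_past[OF W(1)] AE_past[OF W(2)] AE_space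
proof eventually_elim
  case (elim \<omega>)
  then obtain k where k: "S ((prev ^^ k) \<omega>) = 0" by blast
  have "S ((prev ^^ (k - j)) \<omega>) \<le> W ((prev ^^ (k - j)) \<omega>)" if "j \<le> k" for j
    using that
  proof (induction j)
    case 0
    then show ?case using k elim(3) by simp
  next
    case (Suc j)
    then obtain i where i: "k - j = Suc i" "k - Suc j = i" by (metis Suc_diff_Suc Suc_le_lessD)
    have "\<theta> ((prev ^^ Suc i) \<omega>) = (prev ^^ i) \<omega>"
      using elim(5) by simp
    then have "S ((prev ^^ i) \<omega>) \<le> max (S ((prev ^^ Suc i) \<omega>) + X ((prev ^^ Suc i) \<omega>)) 0"
      "W ((prev ^^ i) \<omega>) = max (W ((prev ^^ Suc i) \<omega>) + X ((prev ^^ Suc i) \<omega>)) 0"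
      using elim(2)[rule_format, of "Suc i"] elim(4)[rule_format, of "Suc i"] by simp_all
    then show ?case using Suc unfolding i by auto
  qed
  from this[of k] show ?case by simp
qed

text \<open>Loynes' scheme: the workload at time 0 of a queue started empty at time \<open>-n\<close>.\<close>

primrec loynes :: "('a \<Rightarrow> real) \<Rightarrow> nat \<Rightarrow> 'a \<Rightarrow> real" where
  "loynes X 0 = (\<lambda>_. 0)"
| "loynes X (Suc n) = (\<lambda>\<omega>. max (loynes X n (prev \<omega>) + X (prev \<omega>)) 0)"

lemma loynes_nonneg: "0 \<le> loynes X n \<omega>"
  by (cases n) auto

text \<open>An earlier start can only raise the workload: 0 is the least state and the recursion is
  monotone.\<close>

lemma mono_loynes: "incseq (\<lambda>n. loynes X n \<omega>)"
proof (rule incseq_SucI)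
  show "loynes X n \<omega> \<le> loynes X (Suc n) \<omega>" for n
  proof (induction n arbitrary: \<omega>)
    case (Suc n)
    from Suc[of "prev \<omega>"] show ?case by (auto simp: max_def)
  qed simp
qed

lemma loynes_flow: "\<omega> \<in> space P \<Longrightarrow> loynes X (Suc n) (\<theta> \<omega>) = max (loynes X n \<omega> + X \<omega>) 0"
  by simp

lemma integrable_loynes: "integrable P X \<Longrightarrow> integrable P (loynes X n)"
proof (induction n)
  case (Suc n)
  have "integrable P (\<lambda>\<omega>. loynes X n (prev \<omega>) + X (prev \<omega>))"
    using integrable_prev[of "\<lambda>\<omega>. loynes X n \<omega> + X \<omega>"] Suc by auto
  then show ?case by auto
qed simp

text \<open>If the Loynes workloads were almost surely unbounded, the maximum with 0 would
  eventually be inactive and their mean increments would tend to the integral of \<open>X\<close>.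
  Monotonicity makes these increments nonnegative, a contradiction. Boundedness is an invariant
  event, hence almost sure, and the limit solves the equation by continuity.\<close>

lemma workload_exists:
  fixes X :: "'a \<Rightarrow> real"
  assumes X: "integrable P X" "(\<integral>\<omega>. X \<omega> \<partial>P) < 0"
  obtains W where "W \<in> borel_measurable P" "AE \<omega> in P. 0 \<le> W \<omega>"
    "AE \<omega> in P. W (\<theta> \<omega>) = max (W \<omega> + X \<omega>) 0"
proof -
  note [measurable] = borel_measurable_integrable[OF integrable_loynes[OF X(1)]]
    borel_measurable_integrable[OF X(1)]
  \<comment> \<open>The bound \<open>c\<close> is natural to keep the union countable, hence
    measurable.\<close>
  define D where "D = {\<omega> \<in> space P. \<exists>c::nat. \<forall>n. loynes X n \<omega> \<le> real c}"
  have D[measurable]: "D \<in> sets P" unfolding D_def by measurable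
  have D_flow: "\<theta> \<omega> \<in> D \<longleftrightarrow> \<omega> \<in> D" if "\<omega> \<in> space P" for \<omega>
  proof
    assume "\<theta> \<omega> \<in> D"
    then obtain c :: nat where c: "loynes X n (\<theta> \<omega>) \<le> real c" for n by (auto simp: D_def)
    have "loynes X n \<omega> \<le> real (nat \<lceil>real c - X \<omega>\<rceil>)" for n
      using c[of "Suc n"] unfolding loynes_flow[OF that] by linarith
    then show "\<omega> \<in> D" using that by (auto simp: D_def)
  next
    assume "\<omega> \<in> D"
    then obtain c :: nat where c: "loynes X n \<omega> \<le> real c" for n by (auto simp: D_def)
    have "loynes X n (\<theta> \<omega>) \<le> real (nat \<lceil>real c + X \<omega>\<rceil>)" for n
    proof (cases n)
      case (Suc m)
      show ?thesis using c[of m] unfolding Suc loynes_flow[OF that] by linarith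
    qed simp
    then show "\<theta> \<omega> \<in> D" using that by (auto simp: D_def)
  qed
  have "prob D \<noteq> 0"
  proof
    assume "prob D = 0"
    then have notD: "AE \<omega> in P. \<omega> \<notin> D"
      by (intro AE_I[of _ _ D]) (auto simp: emeasure_eq_measure D_def)
    \<comment> \<open>For a workload \<open>l\<close>,
      \<open>max (l + X) 0 - l = max X (- l)\<close>; since \<open>l \<ge> 0\<close>, this is
      dominated by the absolute value of \<open>X\<close>.\<close>
    let ?Y = "\<lambda>n \<omega>. max (X \<omega>) (- loynes X n \<omega>)"
    have int: "integrable P (loynes X n)" for n by (rule integrable_loynes[OF X(1)])
    have "0 \<le> (\<integral>\<omega>. ?Y n \<omega> \<partial>P)" for n
    proof -
      have "0 \<le> (\<integral>\<omega>. loynes X (Suc n) \<omega> \<partial>P) - (\<integral>\<omega>. loynes X n \<omega> \<partial>P)"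
        using integral_mono[OF int int, of n "Suc n"] incseq_SucD[OF mono_loynes] by simp
      also have "(\<integral>\<omega>. loynes X (Suc n) \<omega> \<partial>P) = (\<integral>\<omega>. loynes X (Suc n) (\<theta> \<omega>) \<partial>P)"
        by (rule integral_flow[symmetric]) measurable
      also have "\<dots> = (\<integral>\<omega>. max (loynes X n \<omega> + X \<omega>) 0 \<partial>P)"
        by (intro Bochner_Integration.integral_cong refl loynes_flow)
      also have "\<dots> - (\<integral>\<omega>. loynes X n \<omega> \<partial>P) = (\<integral>\<omega>. max (loynes X n \<omega> + X \<omega>) 0 - loynes X n \<omega> \<partial>P)"
        using int X by (subst Bochner_Integration.integral_diff) auto
      also have "\<dots> = (\<integral>\<omega>. ?Y n \<omega> \<partial>P)"
        by (intro Bochner_Integration.integral_cong) auto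
      finally show ?thesis .
    qed
    moreover have "(\<lambda>n. \<integral>\<omega>. ?Y n \<omega> \<partial>P) \<longlonglongrightarrow> (\<integral>\<omega>. X \<omega> \<partial>P)"
    proof (rule integral_dominated_convergence[where w = "\<lambda>\<omega>. \<bar>X \<omega>\<bar>"])
      show "AE \<omega> in P. (\<lambda>n. ?Y n \<omega>) \<longlonglongrightarrow> X \<omega>"
        using notD AE_space
      proof eventually_elim
        case (elim \<omega>)
        then obtain N where "real (nat \<lceil>- X \<omega>\<rceil>) < loynes X N \<omega>"
          unfolding D_def by (auto simp: not_le)
        then have "- X \<omega> \<le> loynes X N \<omega>" by linarith
        then have "- loynes X n \<omega> \<le> X \<omega>" if "N \<le> n" for n
          using incseqD[OF mono_loynes[of X \<omega>] that] by linarith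
        then have "eventually (\<lambda>n. ?Y n \<omega> = X \<omega>) sequentially"
          unfolding eventually_sequentially by (intro exI[of _ N]) (auto intro: max_absorb1)
        then show ?case by (rule tendsto_eventually)
      qed
      show "AE \<omega> in P. norm (?Y n \<omega>) \<le> \<bar>X \<omega>\<bar>" for n
      proof (rule AE_I2)
        fix \<omega>
        show "norm (?Y n \<omega>) \<le> \<bar>X \<omega>\<bar>" using loynes_nonneg[of X n \<omega>] by auto
      qed
    qed (use X in auto)
    ultimately have "0 \<le> (\<integral>\<omega>. X \<omega> \<partial>P)"
      by (intro LIMSEQ_le_const) auto
    with X show False by simp
  qed
  with prob_invariant[OF D D_flow] have "prob D = 1" by auto
  then have inD: "AE \<omega> in P. \<omega> \<in> D" by (rule AE_prob_1)
  define W where "W \<omega> = lim (\<lambda>n. loynes X n \<omega>)" for \<omega>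
  have lim: "(\<lambda>n. loynes X n \<omega>) \<longlonglongrightarrow> W \<omega>" if "\<omega> \<in> D" for \<omega>
  proof -
    from that obtain c where "\<And>n. loynes X n \<omega> \<le> c" by (auto simp: D_def)
    then have "convergent (\<lambda>n. loynes X n \<omega>)"
      using incseq_convergent[OF mono_loynes] by (metis convergentI)
    then show ?thesis by (simp add: W_def convergent_LIMSEQ_iff)
  qed
  show thesis
  proof
    show "W \<in> borel_measurable P" unfolding W_def by measurable
    show "AE \<omega> in P. 0 \<le> W \<omega>"
      using inD by eventually_elim (auto intro: LIMSEQ_le_const[OF lim] loynes_nonneg)
    show "AE \<omega> in P. W (\<theta> \<omega>) = max (W \<omega> + X \<omega>) 0"
      using inD AE_space
    proof eventually_elim
      case (elim \<omega>)
      have "(\<lambda>n. loynes X (Suc n) (\<theta> \<omega>)) \<longlonglongrightarrow> W (\<theta> \<omega>)"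
        using elim D_flow by (intro LIMSEQ_Suc lim) auto
      moreover have "(\<lambda>n. loynes X (Suc n) (\<theta> \<omega>)) \<longlonglongrightarrow> max (W \<omega> + X \<omega>) 0"
        unfolding loynes_flow[OF elim(2)] by (intro tendsto_intros lim elim)
      ultimately show ?case by (rule LIMSEQ_unique)
    qed
  qed
qed

end

section \<open>Coupling\<close>

text \<open>Restart property: the state after \<open>m\<close> steps is frozen into a constant
  initial condition for the shifted sample point.\<close>

lemma queue_sequence_add:
  "queue_sequence \<theta> r \<xi> \<sigma> \<zeta> (m + j) \<omega>
    = queue_sequence \<theta> r \<xi> \<sigma> (\<lambda>_. queue_sequence \<theta> r \<xi> \<sigma> \<zeta> m \<omega>) j ((\<theta> ^^ m) \<omega>)"
proof (induction j)
  case (Suc j)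
  have "(\<theta> ^^ (m + j)) \<omega> = (\<theta> ^^ j) ((\<theta> ^^ m) \<omega>)"
    by (metis add.commute comp_apply funpow_add)
  then show ?case using Suc by simp
qed simp

text \<open>Here \<open>f\<close> stands for a power of \<open>prev\<close>: the queue is run from a
  past time up to the present.\<close>

lemma count_measurable_queue_sequence:
  assumes "\<xi> \<in> borel_measurable P" "\<sigma> \<in> borel_measurable P"
    and "\<theta> \<in> P \<rightarrow>\<^sub>M P" "f \<in> P \<rightarrow>\<^sub>M P"
  shows "count_measurable P (\<lambda>\<omega>. queue_sequence \<theta> r \<xi> \<sigma> (\<lambda>_. {#}) n (f \<omega>))"
proof (induction n)
  case (Suc n)
  note [measurable] = assms
  have [measurable]: "(\<lambda>\<omega>. (\<theta> ^^ n) (f \<omega>)) \<in> P \<rightarrow>\<^sub>M P"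
    by (rule measurable_compose[OF assms(4) measurable_compose_n[OF assms(3)]])
  show ?case
    unfolding queue_sequence.simps
    by (intro count_measurable_Phi count_measurable_add Suc; measurable)
qed (simp add: count_measurable_empty)

lemma sum_mset_nonneg_counting: "\<mu> \<in> counting_measures \<Longrightarrow> 0 \<le> \<Sum>\<^sub># \<mu>"
  unfolding counting_measures_def by (induction \<mu>) auto

lemma counting_measure_eq_empty:
  assumes "\<mu> \<in> counting_measures" "\<Sum>\<^sub># \<mu> \<le> 0"
  shows "\<mu> = {#}"
proof (cases \<mu>)
  case (add a \<nu>)
  then have "0 < a" "\<nu> \<in> counting_measures"
    using assms by (auto simp: counting_measures_def)
  then show ?thesis using sum_mset_nonneg_counting[of \<nu>] assms add by simp
qed simp

text \<open>\<open>W\<close> is a parameter because \<open>last_empty\<close> and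
  \<open>stationary_queue\<close> are built from it; \<open>workload_exists\<close> supplies it in
  the end.\<close>

locale processor_sharing = ergodic_automorphism +
  fixes \<xi> \<sigma> :: "'a \<Rightarrow> real" and r :: "nat \<Rightarrow> real" and K :: real and W :: "'a \<Rightarrow> real"
  assumes integrable_\<xi>: "integrable P \<xi>" and \<xi>_pos: "AE \<omega> in P. 0 < \<xi> \<omega>"
    and integrable_\<sigma>: "integrable P \<sigma>" and \<sigma>_pos: "AE \<omega> in P. 0 < \<sigma> \<omega>"
    and r_pos: "\<And>n. 1 \<le> n \<Longrightarrow> 0 < r n" and rate_ge: "\<And>n. 1 \<le> n \<Longrightarrow> K \<le> real n * r n"
    and stable: "(\<integral>\<omega>. \<sigma> \<omega> \<partial>P) < K * (\<integral>\<omega>. \<xi> \<omega> \<partial>P)"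
    and workload: "workload_solution P \<theta> K \<xi> \<sigma> W"
begin

lemma drift: "integrable P (\<lambda>\<omega>. \<sigma> \<omega> - K * \<xi> \<omega>)" "(\<integral>\<omega>. \<sigma> \<omega> - K * \<xi> \<omega> \<partial>P) < 0"
  using integrable_\<xi> integrable_\<sigma> stable by auto

lemma W_measurable [measurable]: "W \<in> borel_measurable P"
  and W_nonneg: "AE \<omega> in P. 0 \<le> W \<omega>"
  and W_flow: "AE \<omega> in P. W (\<theta> \<omega>) = max (W \<omega> + (\<sigma> \<omega> - K * \<xi> \<omega>)) 0"
  using workload by (simp_all add: workload_solution_def add_diff_eq)

lemma W_unique:
  assumes "workload_solution P \<theta> K \<xi> \<sigma> V"
  shows "AE \<omega> in P. V \<omega> = W \<omega>"
proof -
  have V: "V \<in> borel_measurable P" "AE \<omega> in P. 0 \<le> V \<omega>"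
    "AE \<omega> in P. V (\<theta> \<omega>) = max (V \<omega> + (\<sigma> \<omega> - K * \<xi> \<omega>)) 0"
    using assms by (simp_all add: workload_solution_def add_diff_eq)
  have "AE \<omega> in P. V \<omega> \<le> W \<omega>"
    using V(3) by (intro subsolution_le_solution[OF V(1,2) _ W_nonneg W_flow drift])
      (auto elim!: eventually_mono)
  moreover have "AE \<omega> in P. W \<omega> \<le> V \<omega>"
    using W_flow by (intro subsolution_le_solution[OF W_measurable W_nonneg _ V(2,3) drift])
      (auto elim!: eventually_mono)
  ultimately show ?thesis by eventually_elim auto
qed

lemma past_workload_zero: "AE \<omega> in P. \<exists>k. W ((prev ^^ k) \<omega>) = 0"
  using W_flow by (intro subsolution_hits_zero[OF W_measurable W_nonneg _ drift])
    (auto elim!: eventually_mono)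

abbreviation queue :: "('a \<Rightarrow> real multiset) \<Rightarrow> nat \<Rightarrow> 'a \<Rightarrow> real multiset" where
  "queue \<equiv> queue_sequence \<theta> r \<xi> \<sigma>"

lemma work_step:
  assumes "\<mu> \<in> counting_measures" "0 < s" "0 < x"
  shows "\<Sum>\<^sub># (Phi r (\<mu> + {#s#}) x) \<le> max (\<Sum>\<^sub># \<mu> + (s - K * x)) 0"
  using sum_mset_Phi_le[OF r_pos rate_ge, of "\<mu> + {#s#}" x] assms
  by (auto simp: counting_measures_def algebra_simps)

text \<open>Domination of \<open>\<zeta>\<close> holds at every past starting point simultaneously,
  and \<open>work_step\<close> propagates it along each run.\<close>

lemma queue_work_le:
  assumes \<zeta>: "AE \<omega> in P. \<zeta> \<omega> \<in> counting_measures \<and> \<Sum>\<^sub># (\<zeta> \<omega>) \<le> W \<omega>"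
  shows "AE \<omega> in P. \<forall>n. \<forall>j\<le>n. queue \<zeta> j ((prev ^^ n) \<omega>) \<in> counting_measures \<and>
    \<Sum>\<^sub># (queue \<zeta> j ((prev ^^ n) \<omega>)) \<le> W ((prev ^^ (n - j)) \<omega>)"
  using AE_past[OF \<zeta>] AE_past[OF \<xi>_pos] AE_past[OF \<sigma>_pos] AE_past[OF W_flow] AE_space
proof eventually_elim
  case (elim \<omega>)
  have "queue \<zeta> j ((prev ^^ n) \<omega>) \<in> counting_measures \<and>
    \<Sum>\<^sub># (queue \<zeta> j ((prev ^^ n) \<omega>)) \<le> W ((prev ^^ (n - j)) \<omega>)" if "j \<le> n" for j n
    using that
  proof (induction j)
    case 0
    then show ?case using elim by simp
  next
    case (Suc j)
    then obtain i where i: "n - j = Suc i" "n - Suc j = i" by (metis Suc_diff_Suc Suc_le_lessD)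
    define \<mu> where "\<mu> = queue \<zeta> j ((prev ^^ n) \<omega>)"
    define \<rho> where "\<rho> = (prev ^^ Suc i) \<omega>"
    have \<mu>: "\<mu> \<in> counting_measures" "\<Sum>\<^sub># \<mu> \<le> W \<rho>"
      using Suc i by (simp_all add: \<mu>_def \<rho>_def)
    have eq: "queue \<zeta> (Suc j) ((prev ^^ n) \<omega>) = Phi r (\<mu> + {#\<sigma> \<rho>#}) (\<xi> \<rho>)"
      using funpow_flow_prev[OF elim(5), of j n] Suc i by (simp add: \<mu>_def \<rho>_def)
    have "\<Sum>\<^sub># (Phi r (\<mu> + {#\<sigma> \<rho>#}) (\<xi> \<rho>)) \<le> max (W \<rho> + (\<sigma> \<rho> - K * \<xi> \<rho>)) 0"
      using work_step[OF \<mu>(1)] elim \<mu>(2) unfolding \<rho>_def by (smt (verit, best))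
    also have "\<dots> = W (\<theta> \<rho>)" using elim by (simp add: \<rho>_def del: funpow.simps)
    also have "\<theta> \<rho> = (prev ^^ i) \<omega>" using elim by (simp add: \<rho>_def)
    finally show ?case unfolding eq i(2) by (simp add: Phi_in_counting_measures)
  qed
  then show ?case by blast
qed

text \<open>Whenever the dominating workload vanishes, the system is empty and forgets its past.\<close>

lemma queue_couples:
  assumes \<zeta>: "AE \<omega> in P. \<zeta> \<omega> \<in> counting_measures \<and> \<Sum>\<^sub># (\<zeta> \<omega>) \<le> W \<omega>"
  shows "AE \<omega> in P. \<forall>k. W ((prev ^^ k) \<omega>) = 0 \<longrightarrow> (\<forall>n\<ge>k.
    queue \<zeta> n ((prev ^^ n) \<omega>) = queue (\<lambda>_. {#}) k ((prev ^^ k) \<omega>))"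
  using queue_work_le[OF \<zeta>] AE_space
proof eventually_elim
  case (elim \<omega>)
  show ?case
  proof (intro allI impI)
    fix k n assume k: "W ((prev ^^ k) \<omega>) = 0" and n: "k \<le> n"
    \<comment> \<open>Started at time \<open>-n\<close>, the queue is at time \<open>-k\<close>
      after \<open>n - k\<close> steps, and \<open>W\<close> vanishes there; \<open>k\<close> steps
      remain.\<close>
    have "queue \<zeta> (n - k) ((prev ^^ n) \<omega>) = {#}"
      using elim(1)[rule_format, of "n - k" n] k n by (auto intro: counting_measure_eq_empty)
    then show "queue \<zeta> n ((prev ^^ n) \<omega>) = queue (\<lambda>_. {#}) k ((prev ^^ k) \<omega>)"
      using queue_sequence_add[of \<theta> r \<xi> \<sigma> \<zeta> "n - k" k "(prev ^^ n) \<omega>"] n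
        funpow_flow_prev[OF elim(2), of "n - k" n] by simp
  qed
qed

text \<open>The most recent zero of \<open>W\<close>; unspecified on the null set where there is
  none.\<close>

definition last_empty :: "'a \<Rightarrow> nat" where
  "last_empty \<omega> = (LEAST k. W ((prev ^^ k) \<omega>) = 0)"

text \<open>By \<open>queue_couples\<close> any past zero of \<open>W\<close> gives almost surely
  the same state; the least index makes the choice measurable.\<close>

definition stationary_queue :: "'a \<Rightarrow> real multiset" where
  "stationary_queue \<omega> = queue (\<lambda>_. {#}) (last_empty \<omega>) ((prev ^^ last_empty \<omega>) \<omega>)"

text \<open>The coupling time is \<open>last_empty \<omega>\<close>, whatever \<open>\<zeta>\<close>
  is. The zero measure as \<open>\<zeta>\<close> yields existence, a solution as
  \<open>\<zeta>\<close> yields uniqueness.\<close>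

lemma queue_eventually_stationary:
  assumes "AE \<omega> in P. \<zeta> \<omega> \<in> counting_measures \<and> \<Sum>\<^sub># (\<zeta> \<omega>) \<le> W \<omega>"
  shows "AE \<omega> in P. \<exists>N. \<forall>n\<ge>N. queue \<zeta> n ((prev ^^ n) \<omega>) = stationary_queue \<omega>"
  using queue_couples[OF assms] past_workload_zero
proof eventually_elim
  case (elim \<omega>)
  then have "W ((prev ^^ last_empty \<omega>) \<omega>) = 0"
    unfolding last_empty_def by (auto intro: LeastI_ex)
  then show ?case using elim unfolding stationary_queue_def by blast
qed

lemma stationary_queue_measurable: "stationary_queue \<in> P \<rightarrow>\<^sub>M counting_space"
proof (rule measurable_counting_space)
  have [measurable]: "\<xi> \<in> borel_measurable P" "\<sigma> \<in> borel_measurable P"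
    using integrable_\<xi> integrable_\<sigma> by auto
  have "last_empty \<in> P \<rightarrow>\<^sub>M count_space UNIV"
    unfolding last_empty_def by measurable
  then show "count_measurable P stationary_queue"
    unfolding stationary_queue_def
    by (rule count_measurable_compose_countable[rotated]) (rule count_measurable_queue_sequence; measurable)
  have "queue (\<lambda>_. {#}) n \<omega> \<in> counting_measures" for n \<omega>
    by (cases n) (auto simp: Phi_in_counting_measures, simp add: counting_measures_def)
  then show "stationary_queue \<omega> \<in> counting_measures" for \<omega>
    by (simp add: stationary_queue_def)
qed

lemma stationary_queue_solution: "queue_solution P \<theta> r \<xi> \<sigma> stationary_queue"
proof -
  have "AE \<omega> in P. {#} \<in> counting_measures \<and> \<Sum>\<^sub># {#} \<le> W \<omega>"
    using W_nonneg by (simp add: counting_measures_def)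
  note lim = queue_eventually_stationary[OF this]
  have "AE \<omega> in P. \<exists>N. \<forall>n\<ge>N. queue (\<lambda>_. {#}) n ((prev ^^ n) (\<theta> \<omega>)) = stationary_queue (\<theta> \<omega>)"
    using AE_funpow_flow[OF lim, of 1] by simp
  with lim AE_space
  have "AE \<omega> in P. stationary_queue (\<theta> \<omega>) = Phi r (stationary_queue \<omega> + {#\<sigma> \<omega>#}) (\<xi> \<omega>)"
  proof eventually_elim
    case (elim \<omega>)
    then obtain N N' where
      N: "\<And>n. N \<le> n \<Longrightarrow> queue (\<lambda>_. {#}) n ((prev ^^ n) \<omega>) = stationary_queue \<omega>" and
      N': "\<And>n. N' \<le> n \<Longrightarrow> queue (\<lambda>_. {#}) n ((prev ^^ n) (\<theta> \<omega>)) = stationary_queue (\<theta> \<omega>)"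
      by blast
    \<comment> \<open>Beyond both thresholds, the states at \<omega> and \<theta> \<omega> are read
      off a single run from \<open>(prev ^^ n) \<omega>\<close>, after \<open>n\<close> and
      \<open>Suc n\<close> steps.\<close>
    define n where "n = max N N'"
    have "stationary_queue (\<theta> \<omega>) = queue (\<lambda>_. {#}) (Suc n) ((prev ^^ Suc n) (\<theta> \<omega>))"
      by (rule N'[symmetric]) (simp add: n_def)
    also have "\<dots> = queue (\<lambda>_. {#}) (Suc n) ((prev ^^ n) \<omega>)"
      by (simp only: funpow_prev_flow[OF elim(2)])
    also have "\<dots> = Phi r (stationary_queue \<omega> + {#\<sigma> \<omega>#}) (\<xi> \<omega>)"
      using N[of n] funpow_flow_prev[OF elim(2), of n n] by (simp add: n_def)
    finally show ?case .
  qed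
  then show ?thesis by (simp add: queue_solution_def stationary_queue_measurable)
qed

text \<open>The total work of a solution is a subsolution of the workload recursion; this brings
  arbitrary solutions within reach of the coupling.\<close>

lemma queue_solution_work_le:
  assumes "queue_solution P \<theta> r \<xi> \<sigma> \<nu>"
  shows "AE \<omega> in P. \<nu> \<omega> \<in> counting_measures \<and> \<Sum>\<^sub># (\<nu> \<omega>) \<le> W \<omega>"
proof -
  have \<nu>[measurable]: "\<nu> \<in> P \<rightarrow>\<^sub>M counting_space"
    and flow: "AE \<omega> in P. \<nu> (\<theta> \<omega>) = Phi r (\<nu> \<omega> + {#\<sigma> \<omega>#}) (\<xi> \<omega>)"
    using assms by (auto simp: queue_solution_def)
  have cm: "AE \<omega> in P. \<nu> \<omega> \<in> counting_measures"
    using measurable_space[OF \<nu>] by (intro AE_I2) simp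
  have "AE \<omega> in P. \<Sum>\<^sub># (\<nu> \<omega>) \<le> W \<omega>"
  proof (rule subsolution_le_solution[OF _ _ _ W_nonneg W_flow drift])
    show "(\<lambda>\<omega>. \<Sum>\<^sub># (\<nu> \<omega>)) \<in> borel_measurable P"
      by (rule measurable_compose[OF \<nu> measurable_sum_mset])
    show "AE \<omega> in P. 0 \<le> \<Sum>\<^sub># (\<nu> \<omega>)"
      using cm by eventually_elim (rule sum_mset_nonneg_counting)
    show "AE \<omega> in P. \<Sum>\<^sub># (\<nu> (\<theta> \<omega>)) \<le> max (\<Sum>\<^sub># (\<nu> \<omega>) + (\<sigma> \<omega> - K * \<xi> \<omega>)) 0"
      using cm flow \<xi>_pos \<sigma>_pos by eventually_elim (simp only: work_step)
  qed
  with cm show ?thesis by eventually_elim simp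
qed

lemma queue_solution_unique:
  assumes "queue_solution P \<theta> r \<xi> \<sigma> \<nu>"
  shows "AE \<omega> in P. \<nu> \<omega> = stationary_queue \<omega>"
proof -
  have flow: "AE \<omega> in P. \<nu> (\<theta> \<omega>) = Phi r (\<nu> \<omega> + {#\<sigma> \<omega>#}) (\<xi> \<omega>)"
    using assms by (auto simp: queue_solution_def)
  show ?thesis
    using queue_eventually_stationary[OF queue_solution_work_le[OF assms]] AE_past[OF flow] AE_space
  proof eventually_elim
    case (elim \<omega>)
    \<comment> \<open>Started from itself, a solution reproduces itself along the orbit, so the
      coupled sequence is constantly \<open>\<nu> \<omega>\<close>.\<close>
    have "queue \<nu> j ((prev ^^ n) \<omega>) = \<nu> ((prev ^^ (n - j)) \<omega>)" if "j \<le> n" for j n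
      using that
    proof (induction j)
      case (Suc j)
      then obtain i where i: "n - j = Suc i" "n - Suc j = i" by (metis Suc_diff_Suc Suc_le_lessD)
      have "\<theta> ((prev ^^ Suc i) \<omega>) = (prev ^^ i) \<omega>" using elim by simp
      then show ?case
        using Suc i elim(2)[rule_format, of "Suc i"] funpow_flow_prev[OF elim(3), of j n]
        by (simp del: funpow.simps)
    qed simp
    from this[of n n for n] show ?case using elim(1) by auto
  qed
qed

end

theorem theorem2:
  fixes P :: "'a measure" and \<theta> :: "'a \<Rightarrow> 'a" and \<xi> \<sigma> :: "'a \<Rightarrow> real" and r :: "nat \<Rightarrow> real"
  assumes "ergodic_automorphism P \<theta>"
    and "integrable P \<xi>" and "AE \<omega> in P. 0 < \<xi> \<omega>"
    and "integrable P \<sigma>" and "AE \<omega> in P. 0 < \<sigma> \<omega>"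
    and "\<And>n. 1 \<le> n \<Longrightarrow> 0 < r n"
    and "antimono_on {1..} r"
    and "(SUP n\<in>{1..}. ereal (real n * r n)) \<le> 1"
    and "0 < rate_inf r"
    and "(\<integral>\<omega>. \<sigma> \<omega> \<partial>P) < rate_inf r * (\<integral>\<omega>. \<xi> \<omega> \<partial>P)"
  shows "\<exists>\<mu>r. queue_solution P \<theta> r \<xi> \<sigma> \<mu>r
    \<and> (\<forall>\<nu>. queue_solution P \<theta> r \<xi> \<sigma> \<nu> \<longrightarrow> (AE \<omega> in P. \<nu> \<omega> = \<mu>r \<omega>))
    \<and> (\<exists>W. workload_solution P \<theta> (rate_inf r) \<xi> \<sigma> W
         \<and> (\<forall>W'. workload_solution P \<theta> (rate_inf r) \<xi> \<sigma> W' \<longrightarrow> (AE \<omega> in P. W' \<omega> = W \<omega>))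
         \<and> (\<forall>\<zeta>. \<zeta> \<in> P \<rightarrow>\<^sub>M counting_space \<and> (AE \<omega> in P. pairing (\<zeta> \<omega>) (\<lambda>x. x) \<le> W \<omega>) \<longrightarrow>
              strong_backwards_coupling P \<theta> (queue_sequence \<theta> r \<xi> \<sigma> \<zeta>) \<mu>r))"
proof -
  interpret ergodic_automorphism P \<theta> by (rule assms)
  let ?K = "rate_inf r"
  have rate_ge: "?K \<le> real n * r n" if "1 \<le> n" for n
    unfolding rate_inf_def
  proof (rule cINF_lower)
    \<comment> \<open>A real infimum is a lower bound only for sets bounded below.\<close>
    show "bdd_below ((\<lambda>n. real n * r n) ` {1..})"
      using assms(6) by (intro bdd_belowI2[of _ 0]) (auto simp: less_imp_le)
  qed (use that in auto)
  have "integrable P (\<lambda>\<omega>. \<sigma> \<omega> - ?K * \<xi> \<omega>)" "(\<integral>\<omega>. \<sigma> \<omega> - ?K * \<xi> \<omega> \<partial>P) < 0"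
    using assms(2,4,10) by auto
  then obtain W where "W \<in> borel_measurable P" "AE \<omega> in P. 0 \<le> W \<omega>"
    "AE \<omega> in P. W (\<theta> \<omega>) = max (W \<omega> + (\<sigma> \<omega> - ?K * \<xi> \<omega>)) 0"
    by (rule workload_exists)
  then have W: "workload_solution P \<theta> ?K \<xi> \<sigma> W"
    by (simp add: workload_solution_def add_diff_eq)
  interpret processor_sharing P \<theta> \<xi> \<sigma> r ?K W
    by unfold_locales (use assms rate_ge W in auto)
  have "strong_backwards_coupling P \<theta> (queue \<zeta>) stationary_queue"
    if \<zeta>: "\<zeta> \<in> P \<rightarrow>\<^sub>M counting_space" and le: "AE \<omega> in P. pairing (\<zeta> \<omega>) (\<lambda>x. x) \<le> W \<omega>" for \<zeta>
    unfolding strong_backwards_coupling_def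
  proof (rule queue_eventually_stationary)
    show "AE \<omega> in P. \<zeta> \<omega> \<in> counting_measures \<and> \<Sum>\<^sub># (\<zeta> \<omega>) \<le> W \<omega>"
      using le AE_space
    proof eventually_elim
      case (elim \<omega>)
      \<comment> \<open>\<open>pairing_id\<close> turns the pairing into the sum of atoms only for
        positive atoms.\<close>
      then have "\<zeta> \<omega> \<in> counting_measures" using measurable_space[OF \<zeta>] by simp
      then show ?case using elim pairing_id by auto
    qed
  qed
  then show ?thesis
    using stationary_queue_solution queue_solution_unique W W_unique by blast
qed

end
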